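(* The rhmsp $X$ has a version which is almost surely Hölder continuous of any order $\kappa<\hat H$ on every interval $[0,T]$, and moreover, for all $T>0$ and $\varepsilon>0$, almost surely $$\sup_{t,s\in[0,T],\,|t-s|<\delta}|X(t)-X(s)|=o\big(\delta^{\hat H}|\log\delta|^{1/\alpha+1/2+\varepsilon}\big),\quad\delta\to0+.$$
   Context: Fix $\alpha\in(1,2)$. $M$ is an independently scattered rotationally invariant complex S$\alpha$S random measure on $\mathbb R$ with Lebesgue control measure: for every Borel $A$ and $\theta\in\mathbb R$, $e^{i\theta}M(A)\overset{d}{=}M(A)$, $\mathbb E e^{iu\,\mathrm{Re} M(A)}=e^{-\lambda(A)|u|^\alpha}$; values on disjoint Borel subsets of $[0,\infty)$ are independent; $M(-A)=\overline{M(A)}$. For $f$ with $f(-x)=\overline{f(x)}$, $f\in L^\alpha(\mathbb R)$, $\int f\,dM$ is real S$\alpha$S with $\mathbb E\exp(iu\int f dM)=\exp(-|u|^\alpha\|f\|^\alpha_{L^\alpha})$. The Hurst function $H:[0,\infty)\to\mathbb R$ satisfies $0<\hat H:=\inf_t H(t)\le\sup_tH(t)=:\check H<1$, and there are $C>0$, $\gamma>\check H$ with $|H(t)-H(s)|\le C|t-s|^\gamma$ for all $t,s\ge0$. The rhmsp is $X(t)=\int_{\mathbb R}\frac{e^{itx}-1}{|x|^{1/\alpha+H(t)}}M(dx)$, $t\ge0$. *)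

theory Defs
  imports "HOL-Probability.Probability" "HOL-Library.Landau_Symbols"
begin

definition rhmsp_kernel :: "real \<Rightarrow> (real \<Rightarrow> real) \<Rightarrow> real \<Rightarrow> real \<Rightarrow> complex" where
  "rhmsp_kernel \<alpha> H t x = (cis (t * x) - 1) / complex_of_real (\<bar>x\<bar> powr (1 / \<alpha> + H t))"

text \<open>X is (a process with the law of) the rhmsp X(t) = int f_t dM: for all finitely many
  times t_j >= 0 and reals u_j, E exp(i sum_j u_j X(t_j)) = exp(-|| sum_j u_j f_{t_j} ||_alpha^alpha),
  which is exactly the characteristic function of the S-alpha-S integral of sum_j u_j f_{t_j}.\<close>
definition is_rhmsp :: "'a measure \<Rightarrow> real \<Rightarrow> (real \<Rightarrow> real) \<Rightarrow> (real \<Rightarrow> 'a \<Rightarrow> real) \<Rightarrow> bool" where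
  "is_rhmsp P \<alpha> H X \<longleftrightarrow>
     (\<forall>t\<ge>0. X t \<in> borel_measurable P) \<and>
     (\<forall>(n::nat) (ts::nat \<Rightarrow> real) (us::nat \<Rightarrow> real). (\<forall>j<n. 0 \<le> ts j) \<longrightarrow>
        (LINT \<omega>|P. cis (\<Sum>j<n. us j * X (ts j) \<omega>)) =
        complex_of_real (exp (- (LINT x|lborel.
            cmod (\<Sum>j<n. complex_of_real (us j) * rhmsp_kernel \<alpha> H (ts j) x) powr \<alpha>))))"

end

theory Submission
  imports Defs "HOL-Real_Asymp.Real_Asymp"
begin

text \<open>The increments of the process over a time lag \<open>\<delta>\<close> have kernels that share one majorant
  \<open>F\<close> with \<open>L\<^sup>\<alpha>\<close>-norm of order \<open>\<delta>\<close> to the power \<open>Hmin\<close>. For finitely many jointly stable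
  variables with such a common majorant the large jumps are common to all of them: the vector is a
  limit in law of sums \<open>\<Sum>k<N. c U\<^sub>k powr (-1/\<alpha>) Re (b\<^sub>j(\<xi>\<^sub>k) (G\<^sub>k - \<i> G'\<^sub>k))\<close> with \<open>U\<^sub>k\<close> uniform on
  \<open>(0,N]\<close>, \<open>\<xi>\<^sub>k\<close> of density proportional to \<open>F powr \<alpha>\<close> and Gaussian \<open>G\<^sub>k, G'\<^sub>k\<close>, which given \<open>U\<close> and \<open>\<xi>\<close> are
  Gaussian with variances bounded by a single random variable \<open>Q\<close> whose tail is that of a
  positive stable law. Hence the maximum of \<open>m\<close> increments exceeds
  \<open>y \<surd>(log m)\<close> with probability of order \<open>y powr (-\<alpha>)\<close>, without the factor \<open>m\<close> of a union bound.
  At the dyadic scale \<open>n\<close>, with \<open>m\<close> of order \<open>2 ^ n\<close> and \<open>y\<close> of order \<open>n powr (1/\<alpha> + \<epsilon>)\<close> times the norm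
  of \<open>F\<close>, these probabilities are summable, and Borel-Cantelli and chaining give the modulus.\<close>

section \<open>A trapezoid as a Fourier transform\<close>

text \<open>The hypothesis \<open>is_rhmsp\<close> supplies joint characteristic functions only:
  there is no random measure on \<open>P\<close> and nothing to condition on. The Gaussian structure
  therefore lives on auxiliary product spaces, and only a bound on a probability is carried back to
  \<open>P\<close>. Indicators of boxes are discontinuous, so the transfer uses products of
  trapezoids, at the price of a factor 2 between two thresholds. A trapezoid is a combination of
  absolute values, and |a| is a multiple of the integral of 1 - cos (a g) against g^(-2); this is
  the origin of \<open>fejer_mass\<close>. Multiplying a polynomial tail by 2^n would cost a power
  of the lag. In the conditional picture that factor meets only a Gaussian tail, and the root of log
  2^n accounts for the 1/2 in the logarithmic exponent; 1/\<alpha> + \<epsilon> is the price of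
  summing the polynomial tails over n. The dependence of the kernel on H(t) adds an error of order
  lag^\<gamma>, absorbed because \<gamma> exceeds the supremum of H and hence the exponent
  \<open>Hmin\<close> of the main term.\<close>

definition fejer_mass :: real where
  "fejer_mass = (LBINT g. (1 - cos g) / g\<^sup>2)"

lemma one_minus_cos_le:
  fixes x :: real
  shows "1 - cos x \<le> x\<^sup>2 / 2"
proof -
  have "1 - cos x = 2 * (sin (x/2))\<^sup>2"
    using cos_double_sin[of "x/2"] by simp
  also have "\<dots> \<le> 2 * \<bar>x/2\<bar>\<^sup>2"
    using power_mono[OF abs_sin_x_le_abs_x[of "x/2"], of 2] by simp
  finally show ?thesis by (simp add: power2_eq_square)
qed

text \<open>The bounds g^2/2 and 2 for 1 - cos g, the second multiplied by g^2, add up to the single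
  majorant (5/2)/(1 + g^2).\<close>

lemma integrable_fejer_unit: "integrable lborel (\<lambda>g::real. (1 - cos g) / g\<^sup>2)"
proof (rule Bochner_Integration.integrable_bound)
  show "integrable lborel (\<lambda>x::real. (5/2) * inverse (1 + x\<^sup>2))"
    using integrable_inverse_1_plus_square
    by (intro integrable_mult_right) (simp add: set_integrable_def)
  show "AE g::real in lborel. norm ((1 - cos g) / g\<^sup>2) \<le> norm ((5/2) * inverse (1 + g\<^sup>2))"
  proof (rule AE_I2)
    fix g :: real
    show "norm ((1 - cos g) / g\<^sup>2) \<le> norm ((5/2) * inverse (1 + g\<^sup>2))"
    proof (cases "g = 0")
      case False
      have "(1 - cos g) * (1 + g\<^sup>2) \<le> (5/2) * g\<^sup>2"
      proof -
        have "(1 - cos g) * g\<^sup>2 \<le> 2 * g\<^sup>2"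
          using cos_ge_minus_one[of g] by (intro mult_right_mono) auto
        then show ?thesis using one_minus_cos_le[of g] by (simp add: algebra_simps)
      qed
      moreover have "0 < g\<^sup>2" "0 < 1 + g\<^sup>2" using False by (auto simp: add_pos_nonneg)
      ultimately show ?thesis using cos_le_one[of g]
        by (simp add: field_simps)
    qed simp
  qed
qed simp

text \<open>The value is pi, but the constant only normalises and cancels, so positivity is enough.
  It follows since cos g < 1 on (1,2).\<close>

lemma fejer_mass_pos: "0 < fejer_mass"
proof -
  have "0 \<le> fejer_mass" unfolding fejer_mass_def
    by (intro integral_nonneg_AE AE_I2) auto
  moreover have "fejer_mass \<noteq> 0"
  proof
    assume "fejer_mass = 0"
    then have "AE g::real in lborel. (1 - cos g) / g\<^sup>2 = 0"
      unfolding fejer_mass_def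
      using integral_nonneg_eq_0_iff_AE[OF integrable_fejer_unit] by (simp del: divide_eq_0_iff)
    then have "AE g in lborel. g \<notin> {1<..<2::real}"
    proof (rule AE_mp, intro AE_I2 impI notI)
      fix g :: real assume "(1 - cos g) / g\<^sup>2 = 0" and g: "g \<in> {1<..<2}"
      then have "cos g = cos 0" by auto
      moreover have "cos g < cos 0" using g pi_ge_two by (intro cos_monotone_0_pi) auto
      ultimately show False by simp
    qed
    then have "emeasure lborel {1<..<2::real} = 0"
      by (subst (asm) AE_iff_measurable[of "{1<..<2}"]) auto
    then show False by simp
  qed
  ultimately show ?thesis by simp
qed

text \<open>The substitution of a g for g shows that, up to a constant, the absolute value is a
  superposition of the functions 1 - cos (a g). This makes piecewise linear functions accessible to
  characteristic functions.\<close>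

lemma fejer_scaled:
  "integrable lborel (\<lambda>g::real. (1 - cos (a * g)) / g\<^sup>2)" (is ?I)
  "(LBINT g. (1 - cos (a * g)) / g\<^sup>2) = \<bar>a\<bar> * fejer_mass" (is ?E)
proof -
  have *: "?I \<and> ?E" 
  proof (cases "a = 0")
    case False
    have e: "(1 - cos (a * g)) / g\<^sup>2 = a\<^sup>2 * ((1 - cos (0 + a * g)) / (0 + a * g)\<^sup>2)" for g
      using False by (simp add: power_mult_distrib)
    have i: "integrable lborel (\<lambda>g. (1 - cos (0 + a * g)) / (0 + a * g)\<^sup>2)"
      using lborel_integrable_real_affine[OF integrable_fejer_unit False] .
    have "\<bar>a\<bar> * (LBINT g. (1 - cos (0 + a * g)) / (0 + a * g)\<^sup>2) = fejer_mass"
      unfolding fejer_mass_def by (subst (2) lborel_integral_real_affine[OF False, of _ 0]) simp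
    then have ?E
      unfolding e integral_mult_right_zero
      by (metis power2_abs power2_eq_square mult.assoc)
    moreover have ?I unfolding e using i by (rule integrable_mult_right)
    ultimately show ?thesis by blast
  qed simp
  show ?I ?E using * by auto
qed

text \<open>A continuous cutoff: 1 on [-1,1], 0 outside (-2,2), linear in between. It is written
  through absolute values so that \<open>fejer_scaled\<close> applies term by term.\<close>

definition trapezoid :: "real \<Rightarrow> real" where
  "trapezoid x = (\<bar>x + 2\<bar> + \<bar>x - 2\<bar> - \<bar>x + 1\<bar> - \<bar>x - 1\<bar>) / 2"

text \<open>The Fourier density of the trapezoid. It is bounded near 0 and of order g^(-2) at
  infinity, hence absolutely integrable, which a jump in the cutoff would exclude.\<close>

definition trapezoid_freq :: "real \<Rightarrow> real" where
  "trapezoid_freq g = (cos g - cos (2 * g)) / (fejer_mass * g\<^sup>2)"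

text \<open>Pairing the shifts by 2 and -2, and by 1 and -1, turns sums of cosines into products
  with cos (x g); the constants 1 cancel between the four terms.\<close>

lemma trapezoid_fourier_aux:
  "trapezoid_freq g * cos (x * g) =
    ((1 - cos ((x+2) * g)) / g\<^sup>2 + (1 - cos ((x-2) * g)) / g\<^sup>2
      - (1 - cos ((x+1) * g)) / g\<^sup>2 - (1 - cos ((x-1) * g)) / g\<^sup>2) / (2 * fejer_mass)"
proof -
  have "cos ((x+2) * g) + cos ((x-2) * g) = 2 * cos (x*g) * cos (2*g)"
    "cos ((x+1) * g) + cos ((x-1) * g) = 2 * cos (x*g) * cos g"
    by (simp_all add: ring_distribs cos_add cos_diff)
  then have "(1 - cos ((x+2) * g)) + (1 - cos ((x-2) * g)) - (1 - cos ((x+1) * g)) - (1 - cos ((x-1) * g))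
    = 2 * ((cos g - cos (2*g)) * cos (x*g))"
    by (simp add: algebra_simps)
  then have "2 * ((cos g - cos (2*g)) * cos (x*g)) / g\<^sup>2 / (2 * fejer_mass) = 
    ((1 - cos ((x+2) * g)) / g\<^sup>2 + (1 - cos ((x-2) * g)) / g\<^sup>2
      - (1 - cos ((x+1) * g)) / g\<^sup>2 - (1 - cos ((x-1) * g)) / g\<^sup>2) / (2 * fejer_mass)"
    by (simp only: diff_divide_distrib[symmetric] add_divide_distrib[symmetric])
  then show ?thesis unfolding trapezoid_freq_def by (simp add: mult.commute)
qed

lemma trapezoid_fourier:
  "(LBINT g. trapezoid_freq g * cos (x * g)) = trapezoid x"
proof -
  have "(LBINT g. trapezoid_freq g * cos (x * g)) = (\<bar>x + 2\<bar> * fejer_mass + \<bar>x - 2\<bar> * fejer_mass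
      - \<bar>x + 1\<bar> * fejer_mass - \<bar>x - 1\<bar> * fejer_mass) / (2 * fejer_mass)"
    unfolding trapezoid_fourier_aux integral_divide_zero
    by (simp only: Bochner_Integration.integral_diff Bochner_Integration.integral_add
        Bochner_Integration.integrable_diff Bochner_Integration.integrable_add fejer_scaled)
  also have "\<dots> = (\<bar>x + 2\<bar> + \<bar>x - 2\<bar> - \<bar>x + 1\<bar> - \<bar>x - 1\<bar>) * fejer_mass / (2 * fejer_mass)"
    by (simp only: ring_distribs)
  finally show ?thesis using fejer_mass_pos by (simp add: trapezoid_def)
qed

lemma integrable_trapezoid_freq: "integrable lborel trapezoid_freq"
proof -
  have "integrable lborel (\<lambda>g. trapezoid_freq g * cos (0 * g))"
    unfolding trapezoid_fourier_aux
    by (intro integrable_divide Bochner_Integration.integrable_diff Bochner_Integration.integrable_add fejer_scaled)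
  then show ?thesis by simp
qed

lemma trapezoid_measurable [measurable]: "trapezoid \<in> borel_measurable borel"
  unfolding trapezoid_def by measurable

lemma trapezoid_freq_measurable [measurable]: "trapezoid_freq \<in> borel_measurable borel"
  unfolding trapezoid_freq_def by measurable

lemma trapezoid_bounds: "0 \<le> trapezoid x" "trapezoid x \<le> 1"
  and trapezoid_inner: "\<bar>x\<bar> \<le> 1 \<Longrightarrow> trapezoid x = 1"
  and trapezoid_outer: "2 \<le> \<bar>x\<bar> \<Longrightarrow> trapezoid x = 0"
  unfolding trapezoid_def by (auto simp: abs_if split: if_splits)

text \<open>The factor \<open>A\<close> carries whatever depends on the other variables, so one
  trapezoid at a time can be exchanged for cosines. Boundedness of \<open>A\<close> and
  integrability of \<open>trapezoid_freq\<close> justify Fubini.\<close>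

lemma expectation_trapezoid:
  fixes A :: "'a \<Rightarrow> complex"
  assumes "prob_space M" and [measurable]: "Z \<in> borel_measurable M" "A \<in> borel_measurable M"
    and A: "\<And>\<omega>. cmod (A \<omega>) \<le> 1"
  shows "(LINT \<omega>|M. complex_of_real (trapezoid (Z \<omega>)) * A \<omega>) =
    (LBINT g. complex_of_real (trapezoid_freq g) * (LINT \<omega>|M. complex_of_real (cos (Z \<omega> * g)) * A \<omega>))"
proof -
  interpret prob_space M by fact
  interpret pair_sigma_finite M lborel by unfold_locales
  let ?f = "\<lambda>\<omega> g. complex_of_real (trapezoid_freq g) * (complex_of_real (cos (Z \<omega> * g)) * A \<omega>)"
  have bd: "cmod (?f \<omega> g) \<le> norm (trapezoid_freq g)" for \<omega> g
    using mult_left_le[of "\<bar>cos (Z \<omega> * g)\<bar> * cmod (A \<omega>)" "\<bar>trapezoid_freq g\<bar>"]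
      mult_le_one[OF abs_cos_le_one[of "Z \<omega> * g"] _ A[of \<omega>]]
    by (simp add: norm_mult)
  have in1: "integrable lborel (?f \<omega>)" for \<omega>
    by (rule Bochner_Integration.integrable_bound[OF integrable_trapezoid_freq]) (use bd in auto)
  have int: "integrable (M \<Otimes>\<^sub>M lborel) (case_prod ?f)"
  proof (rule Fubini_integrable)
    show "AE \<omega> in M. integrable lborel (\<lambda>g. case_prod ?f (\<omega>, g))" using in1 by simp
    show "integrable M (\<lambda>\<omega>. LBINT g. cmod (case_prod ?f (\<omega>, g)))"
    proof (rule integrable_const_bound[where B="LBINT g. norm (trapezoid_freq g)"])
      show "AE \<omega> in M. norm (LBINT g. cmod (case_prod ?f (\<omega>, g))) \<le> (LBINT g. norm (trapezoid_freq g))"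
      proof (rule AE_I2)
        fix \<omega>
        have "(LBINT g. cmod (?f \<omega> g)) \<le> (LBINT g. norm (trapezoid_freq g))"
          using in1 bd integrable_trapezoid_freq by (intro integral_mono integrable_norm) auto
        moreover have "0 \<le> (LBINT g. cmod (?f \<omega> g))" by (intro integral_nonneg_AE) auto
        ultimately show "norm (LBINT g. cmod (case_prod ?f (\<omega>, g))) \<le> (LBINT g. norm (trapezoid_freq g))"
          by simp
      qed
    qed measurable
  qed measurable
  have "(LBINT g. complex_of_real (trapezoid_freq g) * (LINT \<omega>|M. complex_of_real (cos (Z \<omega> * g)) * A \<omega>))
      = (LBINT g. (LINT \<omega>|M. ?f \<omega> g))"
    by simp
  also have "\<dots> = (LINT \<omega>|M. (LBINT g. ?f \<omega> g))" by (rule Fubini_integral[OF int])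
  also have "\<dots> = (LINT \<omega>|M. complex_of_real (trapezoid (Z \<omega>)) * A \<omega>)"
  proof (intro Bochner_Integration.integral_cong refl)
    fix \<omega>
    have "(LBINT g. ?f \<omega> g) = (LBINT g. complex_of_real (trapezoid_freq g * cos (Z \<omega> * g)) * A \<omega>)"
      by (simp add: mult.assoc)
    also have "\<dots> = complex_of_real (LBINT g. trapezoid_freq g * cos (Z \<omega> * g)) * A \<omega>"
      by (simp only: integral_mult_left_zero integral_complex_of_real)
    finally show "(LBINT g. ?f \<omega> g) = complex_of_real (trapezoid (Z \<omega>)) * A \<omega>"
      by (simp add: trapezoid_fourier)
  qed
  finally show ?thesis by simp
qed

text \<open>The cosines are replaced by trapezoids one coordinate at a time, so that only the
  one-dimensional Fourier representation is needed.\<close>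

lemma trapezoid_product_tendsto:
  fixes M :: "'a measure" and MN :: "nat \<Rightarrow> 'b measure"
    and Z :: "nat \<Rightarrow> 'a \<Rightarrow> real" and W :: "nat \<Rightarrow> nat \<Rightarrow> 'b \<Rightarrow> real"
  assumes M: "prob_space M" and MN: "\<And>N. prob_space (MN N)"
    and Z: "\<And>j. j < m \<Longrightarrow> Z j \<in> borel_measurable M"
    and W: "\<And>N j. j < m \<Longrightarrow> W N j \<in> borel_measurable (MN N)"
    and lim: "\<And>u. (\<lambda>N. LINT \<omega>|MN N. cis (\<Sum>j<m. u j * W N j \<omega>)) \<longlonglongrightarrow> (LINT \<omega>|M. cis (\<Sum>j<m. u j * Z j \<omega>))"
    and "k \<le> m"
  shows "(\<lambda>N. LINT \<omega>|MN N. complex_of_real (\<Prod>j<k. trapezoid (W N j \<omega>)) * cis (\<Sum>j<m. u j * W N j \<omega>))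
    \<longlonglongrightarrow> (LINT \<omega>|M. complex_of_real (\<Prod>j<k. trapezoid (Z j \<omega>)) * cis (\<Sum>j<m. u j * Z j \<omega>))"
  using \<open>k \<le> m\<close>
\<comment> \<open>The frequencies stay arbitrary since removing the trapezoid of coordinate
  \<open>k\<close> shifts \<open>u k\<close> in both directions.\<close>
proof (induction k arbitrary: u)
  case 0
  then show ?case using lim by simp
next
  case (Suc k)
  then have km: "k < m" by simp
  define V where "V = (\<lambda>g. u(k := u k + g))"
  have shift: "(\<Sum>j<m. V g j * f j) = (\<Sum>j<m. u j * f j) + f k * g" for g and f :: "nat \<Rightarrow> real"
    unfolding V_def using km
    by (simp add: sum.remove[of "{..<m}" k] algebra_simps)
  \<comment> \<open>Multiplication by the cosine averages the two phases in which \<open>u k\<close>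
    is replaced by \<open>u k + g\<close> and \<open>u k - g\<close>.\<close>
  have split: "complex_of_real (cos (f k * g)) * (complex_of_real p * cis (\<Sum>j<m. u j * f j)) =
      (complex_of_real p * cis (\<Sum>j<m. V g j * f j) + complex_of_real p * cis (\<Sum>j<m. V (- g) j * f j)) / 2"
    for p g and f :: "nat \<Rightarrow> real"
    unfolding shift by (simp add: complex_eq_iff cos_add sin_add cos_diff sin_diff algebra_simps)
  have pb: "cmod (complex_of_real (\<Prod>j<k. trapezoid (f j)) * cis s) \<le> 1" for f s
    using trapezoid_bounds
    by (simp add: norm_mult abs_prod prod_le_1 norm_of_real del: of_real_prod)
  have main: "(LINT \<omega>|Q. complex_of_real (\<Prod>j<Suc k. trapezoid (Y j \<omega>)) * cis (\<Sum>j<m. u j * Y j \<omega>)) =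
      (LBINT g. complex_of_real (trapezoid_freq g) *
        (((LINT \<omega>|Q. complex_of_real (\<Prod>j<k. trapezoid (Y j \<omega>)) * cis (\<Sum>j<m. V g j * Y j \<omega>)) +
         (LINT \<omega>|Q. complex_of_real (\<Prod>j<k. trapezoid (Y j \<omega>)) * cis (\<Sum>j<m. V (- g) j * Y j \<omega>))) / 2))"
    if Q: "prob_space Q" and Y: "\<And>j. j < m \<Longrightarrow> Y j \<in> borel_measurable Q"
    for Q :: "'c measure" and Y :: "nat \<Rightarrow> 'c \<Rightarrow> real"
  proof -
    interpret prob_space Q by fact
    have mm: "(\<lambda>\<omega>. complex_of_real (\<Prod>j<k. trapezoid (Y j \<omega>)) * cis (\<Sum>j<m. v j * Y j \<omega>)) \<in> borel_measurable Q"
      for v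
    proof -
      have 1: "(\<lambda>\<omega>. \<Prod>j<k. trapezoid (Y j \<omega>)) \<in> borel_measurable Q"
        using Y km by (intro borel_measurable_prod measurable_compose[OF _ trapezoid_measurable]) auto
      have 2: "(\<lambda>\<omega>. \<Sum>j<m. v j * Y j \<omega>) \<in> borel_measurable Q"
        using Y by (intro borel_measurable_sum borel_measurable_times) auto
      note [measurable] = 1 2
      show ?thesis unfolding cis_conv_exp by measurable
    qed
    have i: "integrable Q (\<lambda>\<omega>. complex_of_real (\<Prod>j<k. trapezoid (Y j \<omega>)) * cis (\<Sum>j<m. v j * Y j \<omega>))" for v
      by (intro integrable_const_bound[where B=1] AE_I2 pb mm)
    have "(LINT \<omega>|Q. complex_of_real (\<Prod>j<Suc k. trapezoid (Y j \<omega>)) * cis (\<Sum>j<m. u j * Y j \<omega>)) =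
      (LINT \<omega>|Q. complex_of_real (trapezoid (Y k \<omega>)) * (complex_of_real (\<Prod>j<k. trapezoid (Y j \<omega>)) * cis (\<Sum>j<m. u j * Y j \<omega>)))"
      by (simp add: mult_ac)
    also have "\<dots> = (LBINT g. complex_of_real (trapezoid_freq g) * (LINT \<omega>|Q. complex_of_real (cos (Y k \<omega> * g)) *
        (complex_of_real (\<Prod>j<k. trapezoid (Y j \<omega>)) * cis (\<Sum>j<m. u j * Y j \<omega>))))"
      by (intro expectation_trapezoid[OF Q] Y[OF km] pb mm)
    also have "\<dots> = (LBINT g. complex_of_real (trapezoid_freq g) *
        (LINT \<omega>|Q. (complex_of_real (\<Prod>j<k. trapezoid (Y j \<omega>)) * cis (\<Sum>j<m. V g j * Y j \<omega>) +
          complex_of_real (\<Prod>j<k. trapezoid (Y j \<omega>)) * cis (\<Sum>j<m. V (- g) j * Y j \<omega>)) / 2))"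
      by (simp only: split[of "\<lambda>j. Y j \<omega>" for \<omega>])
    finally show ?thesis
      by (simp only: integral_divide_zero Bochner_Integration.integral_add[OF i i])
  qed
  have meas: "(\<lambda>g. LINT \<omega>|Q. complex_of_real (\<Prod>j<k. trapezoid (Y j \<omega>)) * cis (\<Sum>j<m. V (c * g) j * Y j \<omega>))
      \<in> borel_measurable lborel"
    if Q: "prob_space Q" and Y: "\<And>j. j < m \<Longrightarrow> Y j \<in> borel_measurable Q"
    for Q :: "'c measure" and Y :: "nat \<Rightarrow> 'c \<Rightarrow> real" and c
  proof -
    interpret prob_space Q by fact
    define p where "p = (\<lambda>\<omega>. \<Prod>j<k. trapezoid (Y j \<omega>))"
    define S where "S = (\<lambda>\<omega>. \<Sum>j<m. u j * Y j \<omega>)"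
    have [measurable]: "p \<in> borel_measurable Q" unfolding p_def
      using Y km by (intro borel_measurable_prod measurable_compose[OF _ trapezoid_measurable]) auto
    have [measurable]: "S \<in> borel_measurable Q" unfolding S_def
      using Y by (intro borel_measurable_sum borel_measurable_times) auto
    have [measurable]: "Y k \<in> borel_measurable Q" using Y km by auto
    have "(\<lambda>g. LINT \<omega>|Q. complex_of_real (p \<omega>) * cis (S \<omega> + Y k \<omega> * (c * g))) \<in> borel_measurable lborel"
      unfolding cis_conv_exp by measurable
    then show ?thesis unfolding shift p_def S_def .
  qed
  have mainZ: "(LINT \<omega>|M. complex_of_real (\<Prod>j<Suc k. trapezoid (Z j \<omega>)) * cis (\<Sum>j<m. u j * Z j \<omega>)) =
      (LBINT g. complex_of_real (trapezoid_freq g) *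
        (((LINT \<omega>|M. complex_of_real (\<Prod>j<k. trapezoid (Z j \<omega>)) * cis (\<Sum>j<m. V g j * Z j \<omega>)) +
         (LINT \<omega>|M. complex_of_real (\<Prod>j<k. trapezoid (Z j \<omega>)) * cis (\<Sum>j<m. V (- g) j * Z j \<omega>))) / 2))"
    by (rule main[OF M Z])
  have mainW: "(LINT \<omega>|MN N. complex_of_real (\<Prod>j<Suc k. trapezoid (W N j \<omega>)) * cis (\<Sum>j<m. u j * W N j \<omega>)) =
      (LBINT g. complex_of_real (trapezoid_freq g) *
        (((LINT \<omega>|MN N. complex_of_real (\<Prod>j<k. trapezoid (W N j \<omega>)) * cis (\<Sum>j<m. V g j * W N j \<omega>)) +
         (LINT \<omega>|MN N. complex_of_real (\<Prod>j<k. trapezoid (W N j \<omega>)) * cis (\<Sum>j<m. V (- g) j * W N j \<omega>))) / 2))" for N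
    by (rule main[OF MN W])
  show ?case
    unfolding mainZ mainW
  \<comment> \<open>For each g the induction hypothesis applies to both shifted frequency vectors.
    The inner expectations have modulus at most 1, so \<open>trapezoid_freq\<close> itself
    dominates.\<close>
  proof (rule integral_dominated_convergence[where w="\<lambda>g. \<bar>trapezoid_freq g\<bar>"])
    show "integrable lborel (\<lambda>g. \<bar>trapezoid_freq g\<bar>)" using integrable_trapezoid_freq by simp
    show "AE g in lborel. (\<lambda>N. complex_of_real (trapezoid_freq g) *
        (((LINT \<omega>|MN N. complex_of_real (\<Prod>j<k. trapezoid (W N j \<omega>)) * cis (\<Sum>j<m. V g j * W N j \<omega>)) +
         (LINT \<omega>|MN N. complex_of_real (\<Prod>j<k. trapezoid (W N j \<omega>)) * cis (\<Sum>j<m. V (- g) j * W N j \<omega>))) / 2))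
      \<longlonglongrightarrow> complex_of_real (trapezoid_freq g) *
        (((LINT \<omega>|M. complex_of_real (\<Prod>j<k. trapezoid (Z j \<omega>)) * cis (\<Sum>j<m. V g j * Z j \<omega>)) +
         (LINT \<omega>|M. complex_of_real (\<Prod>j<k. trapezoid (Z j \<omega>)) * cis (\<Sum>j<m. V (- g) j * Z j \<omega>))) / 2)"
      using Suc by (intro AE_I2 tendsto_mult tendsto_divide tendsto_add tendsto_const) auto
    have n1: "cmod (LINT \<omega>|Q. complex_of_real (\<Prod>j<k. trapezoid (Y j \<omega>)) * cis (\<Sum>j<m. v j * Y j \<omega>)) \<le> 1"
      if Q: "prob_space Q" for Q :: "'c measure" and Y :: "nat \<Rightarrow> 'c \<Rightarrow> real" and v
    proof -
      interpret prob_space Q by fact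
      show ?thesis
      proof (cases "integrable Q (\<lambda>\<omega>. complex_of_real (\<Prod>j<k. trapezoid (Y j \<omega>)) * cis (\<Sum>j<m. v j * Y j \<omega>))")
        case True
        have "cmod (LINT \<omega>|Q. complex_of_real (\<Prod>j<k. trapezoid (Y j \<omega>)) * cis (\<Sum>j<m. v j * Y j \<omega>))
          \<le> (LINT \<omega>|Q. cmod (complex_of_real (\<Prod>j<k. trapezoid (Y j \<omega>)) * cis (\<Sum>j<m. v j * Y j \<omega>)))"
          by (rule integral_norm_bound)
        also have "\<dots> \<le> (LINT \<omega>|Q. 1)" using True pb by (intro integral_mono integrable_norm) auto
        finally show ?thesis by (simp add: prob_space)
      qed (simp add: not_integrable_integral_eq)
    qed
    fix N
    show "AE g in lborel. cmod (complex_of_real (trapezoid_freq g) *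
        (((LINT \<omega>|MN N. complex_of_real (\<Prod>j<k. trapezoid (W N j \<omega>)) * cis (\<Sum>j<m. V g j * W N j \<omega>)) +
         (LINT \<omega>|MN N. complex_of_real (\<Prod>j<k. trapezoid (W N j \<omega>)) * cis (\<Sum>j<m. V (- g) j * W N j \<omega>))) / 2))
      \<le> \<bar>trapezoid_freq g\<bar>"
    proof (rule AE_I2)
      fix g
      have "cmod (((LINT \<omega>|MN N. complex_of_real (\<Prod>j<k. trapezoid (W N j \<omega>)) * cis (\<Sum>j<m. V g j * W N j \<omega>)) +
         (LINT \<omega>|MN N. complex_of_real (\<Prod>j<k. trapezoid (W N j \<omega>)) * cis (\<Sum>j<m. V (- g) j * W N j \<omega>))) / 2) \<le> 1"
        using norm_triangle_mono[OF n1[OF MN, of N "W N" "V g"] n1[OF MN, of N "W N" "V (-g)"]]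
        by (simp add: norm_divide)
      then show "cmod (complex_of_real (trapezoid_freq g) *
        (((LINT \<omega>|MN N. complex_of_real (\<Prod>j<k. trapezoid (W N j \<omega>)) * cis (\<Sum>j<m. V g j * W N j \<omega>)) +
         (LINT \<omega>|MN N. complex_of_real (\<Prod>j<k. trapezoid (W N j \<omega>)) * cis (\<Sum>j<m. V (- g) j * W N j \<omega>))) / 2))
      \<le> \<bar>trapezoid_freq g\<bar>"
        unfolding norm_mult norm_of_real by (intro mult_left_le) auto
    qed
    have "(\<lambda>g. LINT \<omega>|MN N. complex_of_real (\<Prod>j<k. trapezoid (W N j \<omega>)) * cis (\<Sum>j<m. V (c * g) j * W N j \<omega>))
      \<in> borel_measurable lborel" for c
      by (rule meas[OF MN W])
    from this[of 1] this[of "-1"] show "(\<lambda>g. complex_of_real (trapezoid_freq g) *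
        (((LINT \<omega>|MN N. complex_of_real (\<Prod>j<k. trapezoid (W N j \<omega>)) * cis (\<Sum>j<m. V g j * W N j \<omega>)) +
         (LINT \<omega>|MN N. complex_of_real (\<Prod>j<k. trapezoid (W N j \<omega>)) * cis (\<Sum>j<m. V (- g) j * W N j \<omega>))) / 2))
      \<in> borel_measurable lborel" by simp
  next
    have "(\<lambda>g. LINT \<omega>|M. complex_of_real (\<Prod>j<k. trapezoid (Z j \<omega>)) * cis (\<Sum>j<m. V (c * g) j * Z j \<omega>))
      \<in> borel_measurable lborel" for c
      by (rule meas[OF M Z])
    from this[of 1] this[of "-1"] show "(\<lambda>g. complex_of_real (trapezoid_freq g) *
        (((LINT \<omega>|M. complex_of_real (\<Prod>j<k. trapezoid (Z j \<omega>)) * cis (\<Sum>j<m. V g j * Z j \<omega>)) +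
         (LINT \<omega>|M. complex_of_real (\<Prod>j<k. trapezoid (Z j \<omega>)) * cis (\<Sum>j<m. V (- g) j * Z j \<omega>))) / 2))
      \<in> borel_measurable lborel" by simp
  qed
qed

section \<open>The stable Levy measure\<close>

text \<open>The constant in the representation of a^\<alpha> as an integral over w > 0 of one minus
  the Gaussian characteristic function at a w^(-1/\<alpha>). Lebesgue measure in w corresponds to
  the stable jump intensity \<alpha> x^(-\<alpha> - 1) dx for the size x = w^(-1/\<alpha>).\<close>

definition levy_mass :: "real \<Rightarrow> real" where
  "levy_mass \<alpha> = (LINT w:{0<..}|lborel. 1 - exp (- (w powr (-2/\<alpha>)) / 2))"

lemma set_integrable_powr_at_infinity:
  fixes e :: real
  assumes "e < -1"
  shows "set_integrable lborel {1..} (\<lambda>x. x powr e)"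
proof -
  have "(\<lambda>x. x powr e) integrable_on {1..}"
    using has_integral_powr_to_inf[OF assms, of 1] by auto
  then have "(\<lambda>x. x powr e) absolutely_integrable_on {1..}"
    by (rule nonnegative_absolutely_integrable_1) auto
  then show ?thesis
    unfolding set_integrable_def by (subst (asm) integrable_completion) auto
qed

lemma set_integrable_powr_at_0:
  fixes e :: real
  assumes "e > -1"
  shows "set_integrable lborel {0..1} (\<lambda>x. x powr e)"
proof -
  have "(\<lambda>x. x powr e) integrable_on {0..1}"
    using has_integral_powr_from_0[OF assms, of 1] by auto
  then have "(\<lambda>x. x powr e) absolutely_integrable_on {0..1}"
    by (rule nonnegative_absolutely_integrable_1) auto
  then show ?thesis
    unfolding set_integrable_def by (subst (asm) integrable_completion) auto
qed

context
  fixes \<alpha> :: real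
  assumes \<alpha>: "0 < \<alpha>" "\<alpha> < 2"
begin

text \<open>Near 0 the integrand is at most 1; at infinity it is at most w^(-2/\<alpha>), which is
  integrable because \<alpha> < 2.\<close>

lemma levy_integrable_unit: "set_integrable lborel {0<..} (\<lambda>w. 1 - exp (- (w powr (-2/\<alpha>)) / 2))"
proof -
  have "set_integrable lborel {0<..<1} (\<lambda>w. 1 - exp (- (w powr (-2/\<alpha>)) / 2))"
    unfolding set_integrable_def
    by (rule Bochner_Integration.integrable_bound[OF integrable_real_indicator[of "{0<..<1}"]])
      (auto simp: indicator_def)
  moreover have "set_integrable lborel {1..} (\<lambda>w. 1 - exp (- (w powr (-2/\<alpha>)) / 2))"
    unfolding set_integrable_def
  proof (rule Bochner_Integration.integrable_bound)
    show "integrable lborel (\<lambda>w. indicator {1..} w *\<^sub>R (w powr (-2/\<alpha>)))"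
      using set_integrable_powr_at_infinity[of "-2/\<alpha>"] \<alpha>
      by (simp add: set_integrable_def field_simps)
    have "1 - exp (- (v / 2)) \<le> v" if "0 \<le> v" for v :: real
      using exp_ge_add_one_self[of "-(v/2)"] that by simp
    then show "AE w in lborel. norm (indicator {1..} w *\<^sub>R (1 - exp (- (w powr (- 2 / \<alpha>)) / 2)))
      \<le> norm (indicator {1..} w *\<^sub>R w powr (- 2 / \<alpha>))"
      by (auto simp: indicator_def)
  qed simp
  ultimately have "set_integrable lborel ({0<..<1} \<union> {1..}) (\<lambda>w. 1 - exp (- (w powr (-2/\<alpha>)) / 2))"
    by (rule set_integrable_Un) auto
  moreover have "{0<..<1} \<union> {1..} = {0::real<..}" by auto
  ultimately show ?thesis by simp
qed

text \<open>Rescaling w by a^(-\<alpha>) absorbs a^2 into the power and brings out the Jacobian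
  a^\<alpha>. This is how a stable exponent arises from Gaussian ones.\<close>

lemma levy_scaled:
  assumes "0 \<le> a"
  shows "set_integrable lborel {0<..} (\<lambda>w. 1 - exp (- (a\<^sup>2 * w powr (-2/\<alpha>)) / 2))"
    and "(LINT w:{0<..}|lborel. 1 - exp (- (a\<^sup>2 * w powr (-2/\<alpha>)) / 2)) = levy_mass \<alpha> * a powr \<alpha>"
proof -
  let ?f = "\<lambda>w. indicator {0<..} w *\<^sub>R (1 - exp (- (w powr (-2/\<alpha>)) / 2)) :: real"
  let ?g = "\<lambda>w. indicator {0<..} w *\<^sub>R (1 - exp (- (a\<^sup>2 * w powr (-2/\<alpha>)) / 2)) :: real"
  have "integrable lborel ?g \<and> integral\<^sup>L lborel ?g = levy_mass \<alpha> * a powr \<alpha>"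
  proof (cases "a = 0")
    case False
    define c where "c = a powr (- \<alpha>)"
    have c: "c > 0" using False assms by (simp add: c_def)
    have "(c * w) powr (-2/\<alpha>) = a\<^sup>2 * w powr (-2/\<alpha>)" if "w > 0" for w
      using False assms \<alpha> that c
      by (simp add: c_def powr_mult powr_powr powr_numeral)
    then have fg: "?f (0 + c * w) = ?g w" for w
      using c by (auto simp: indicator_def zero_less_mult_iff)
    have i: "integrable lborel ?g"
      using lborel_integrable_real_affine[OF levy_integrable_unit[unfolded set_integrable_def], of c 0] c
      unfolding fg by simp
    have "levy_mass \<alpha> = \<bar>c\<bar> *\<^sub>R integral\<^sup>L lborel ?g"
      unfolding fg[symmetric] levy_mass_def set_lebesgue_integral_def
      using c by (intro lborel_integral_real_affine) auto
    then have "integral\<^sup>L lborel ?g = levy_mass \<alpha> * a powr \<alpha>"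
      using False assms by (simp add: c_def powr_minus field_simps)
    then show ?thesis using i by blast
  qed (use \<alpha> in simp)
  then show "set_integrable lborel {0<..} (\<lambda>w. 1 - exp (- (a\<^sup>2 * w powr (-2/\<alpha>)) / 2))"
    "(LINT w:{0<..}|lborel. 1 - exp (- (a\<^sup>2 * w powr (-2/\<alpha>)) / 2)) = levy_mass \<alpha> * a powr \<alpha>"
    by (auto simp: set_integrable_def set_lebesgue_integral_def)
qed

lemma levy_mass_pos: "0 < levy_mass \<alpha>"
proof -
  have i: "integrable lborel (\<lambda>w::real. indicator {0<..} w *\<^sub>R (1 - exp (- (w powr (-2/\<alpha>)) / 2)))"
    using levy_integrable_unit by (simp add: set_integrable_def)
  have nn: "0 \<le> indicator {0<..} w *\<^sub>R (1 - exp (- (w powr (-2/\<alpha>)) / 2))" for w :: real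
    by (auto simp: indicator_def)
  have "0 \<le> levy_mass \<alpha>" unfolding levy_mass_def set_lebesgue_integral_def
    using nn by (intro integral_nonneg_AE AE_I2) auto
  moreover have "levy_mass \<alpha> \<noteq> 0"
  proof
    assume "levy_mass \<alpha> = 0"
    then have "AE w::real in lborel. indicator {0<..} w *\<^sub>R (1 - exp (- (w powr (-2/\<alpha>)) / 2)) = 0"
      unfolding levy_mass_def set_lebesgue_integral_def
      by (subst (asm) integral_nonneg_eq_0_iff_AE[OF i]) (use nn in auto)
    then have "AE w in lborel. w \<notin> {1<..<2::real}"
      by (rule AE_mp, intro AE_I2) (auto simp: indicator_def)
    then have "emeasure lborel {1<..<2::real} = 0"
      by (subst (asm) AE_iff_measurable[of "{1<..<2}"]) auto
    then show False by simp
  qed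
  ultimately show ?thesis by simp
qed

text \<open>For \<open>U\<close> uniform on \<open>(0,N]\<close>, \<open>levy_trunc N a / N\<close> is one minus the expectation of
  \<open>exp (- (a * U powr (-1/\<alpha>))\<^sup>2 / 2)\<close>.\<close>

definition levy_trunc :: "nat \<Rightarrow> real \<Rightarrow> real" where
  "levy_trunc N a = (LINT w:{0<..real N}|lborel. 1 - exp (- (a\<^sup>2 * w powr (-2/\<alpha>)) / 2))"

text \<open>The bounds 0 and \<open>N\<close> keep the base of an N-th power within [0,1]; the bound
  by the full integral supplies domination in \<open>N\<close> and the tail estimate.\<close>

lemma levy_trunc_bounds:
  assumes "0 \<le> a"
  shows "0 \<le> levy_trunc N a" "levy_trunc N a \<le> levy_mass \<alpha> * a powr \<alpha>" "levy_trunc N a \<le> N"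
proof -
  have i: "set_integrable lborel {0<..real N} (\<lambda>w. 1 - exp (- (a\<^sup>2 * w powr (-2/\<alpha>)) / 2))"
    by (rule set_integrable_subset[OF levy_scaled(1)[OF assms]]) auto
  show "0 \<le> levy_trunc N a"
    unfolding levy_trunc_def set_lebesgue_integral_def
    by (intro integral_nonneg_AE AE_I2) (auto simp: indicator_def)
  show "levy_trunc N a \<le> levy_mass \<alpha> * a powr \<alpha>"
    unfolding levy_trunc_def levy_scaled(2)[OF assms, symmetric]
    using i levy_scaled(1)[OF assms] unfolding set_lebesgue_integral_def set_integrable_def
    by (intro integral_mono) (auto simp: indicator_def)
  have "levy_trunc N a \<le> (LINT w:{0<..real N}|lborel. 1)"
    unfolding levy_trunc_def set_lebesgue_integral_def
    by (intro integral_mono i[unfolded set_integrable_def]) (auto simp: mult_left_le)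
  then show "levy_trunc N a \<le> N" by (simp add: set_lebesgue_integral_def)
qed

lemma levy_trunc_tendsto:
  assumes "0 \<le> a"
  shows "(\<lambda>N. levy_trunc N a) \<longlonglongrightarrow> levy_mass \<alpha> * a powr \<alpha>"
  unfolding levy_trunc_def levy_scaled(2)[OF assms, symmetric] set_lebesgue_integral_def
proof (rule integral_dominated_convergence)
  show "integrable lborel (\<lambda>w. indicator {0<..} w *\<^sub>R (1 - exp (- (a\<^sup>2 * w powr (-2/\<alpha>)) / 2)))"
    using levy_scaled(1)[OF assms] unfolding set_integrable_def .
  show "AE w in lborel. (\<lambda>N. indicator {0<..real N} w *\<^sub>R (1 - exp (- (a\<^sup>2 * w powr (-2/\<alpha>)) / 2)))
    \<longlonglongrightarrow> indicator {0<..} w *\<^sub>R (1 - exp (- (a\<^sup>2 * w powr (-2/\<alpha>)) / 2))"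
  proof (intro AE_I2 tendsto_eventually)
    fix w :: real
    show "\<forall>\<^sub>F N in sequentially. indicator {0<..real N} w *\<^sub>R (1 - exp (- (a\<^sup>2 * w powr (-2/\<alpha>)) / 2)) =
      indicator {0<..} w *\<^sub>R (1 - exp (- (a\<^sup>2 * w powr (-2/\<alpha>)) / 2))"
      using eventually_ge_at_top[of "nat \<lceil>w\<rceil>"]
      by eventually_elim (auto simp: indicator_def)
  qed
qed (auto simp: indicator_def)

lemma levy_trunc_measurable [measurable]: "levy_trunc N \<in> borel_measurable borel"
  unfolding levy_trunc_def set_lebesgue_integral_def by measurable

end

section \<open>Sums of conditionally Gaussian atoms\<close>

lemma cis_measurable [measurable]: "cis \<in> borel_measurable borel"
  unfolding cis_conv_exp by measurable

lemma std_normal_cis: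
  "(LINT g|std_normal_distribution. cis (a * g)) = complex_of_real (exp (- a\<^sup>2 / 2))"
  using fun_cong[OF char_std_normal_distribution, of a] by (simp add: char_def cis_conv_exp)

text \<open>Completing the square: the tilted density is exp (s^2/2) times the normal density with
  mean s.\<close>

lemma std_normal_mgf:
  "(\<integral>\<^sup>+g. ennreal (exp (s * g)) \<partial>std_normal_distribution) = ennreal (exp (s\<^sup>2 / 2))"
proof -
  interpret N: prob_space "density lborel (normal_density s 1)" by (rule prob_space_normal_density) simp
  have e: "std_normal_density g * exp (s * g) = exp (s\<^sup>2 / 2) * normal_density s 1 g" for g
    by (simp add: normal_density_def mult_exp_exp power2_eq_square field_simps)
  have "(\<integral>\<^sup>+g. ennreal (exp (s * g)) \<partial>std_normal_distribution) =
    (\<integral>\<^sup>+g. ennreal (exp (s\<^sup>2 / 2)) * ennreal (normal_density s 1 g) \<partial>lborel)"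
    by (subst nn_integral_density) (auto simp: ennreal_mult'[symmetric] e)
  also have "\<dots> = ennreal (exp (s\<^sup>2 / 2)) * emeasure (density lborel (normal_density s 1)) UNIV"
    by (simp add: nn_integral_cmult emeasure_density)
  also have "\<dots> = ennreal (exp (s\<^sup>2 / 2))"
    using N.emeasure_space_1 by simp
  finally show ?thesis .
qed

abbreviation gauss2 :: "(real \<times> real) measure" where
  "gauss2 \<equiv> std_normal_distribution \<Otimes>\<^sub>M std_normal_distribution"

lemma prob_space_std_normal: "prob_space std_normal_distribution"
  by (rule prob_space_normal_density) simp

lemma prob_space_gauss2: "prob_space gauss2"
  by (intro prob_space_pair prob_space_std_normal)

lemma gauss2_cis:
  "(LINT p|gauss2. cis (a * fst p + b * snd p)) = complex_of_real (exp (- (a\<^sup>2 + b\<^sup>2) / 2))"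
proof -
  interpret prob_space std_normal_distribution by (rule prob_space_std_normal)
  interpret G: prob_space gauss2 by (rule prob_space_gauss2)
  interpret pair_sigma_finite std_normal_distribution std_normal_distribution by unfold_locales
  have "integrable gauss2 (\<lambda>p. cis (a * fst p + b * snd p))"
    by (rule G.integrable_const_bound[where B=1]) auto
  then have "(LINT p|gauss2. cis (a * fst p + b * snd p)) =
    (LINT x|std_normal_distribution. LINT y|std_normal_distribution. cis (a * x) * cis (b * y))"
    by (subst integral_fst'[symmetric]) (auto simp: cis_mult)
  moreover have "exp (- a\<^sup>2 / 2) * exp (- b\<^sup>2 / 2) = exp (- (a\<^sup>2 + b\<^sup>2) / 2)"
    by (simp add: mult_exp_exp add_divide_distrib)
  ultimately show ?thesis
    by (simp add: std_normal_cis flip: of_real_mult)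
qed

lemma gauss2_mgf:
  "(\<integral>\<^sup>+p. ennreal (exp (a * fst p + b * snd p)) \<partial>gauss2) = ennreal (exp ((a\<^sup>2 + b\<^sup>2) / 2))"
proof -
  interpret prob_space std_normal_distribution by (rule prob_space_std_normal)
  have "(\<integral>\<^sup>+p. ennreal (exp (a * fst p + b * snd p)) \<partial>gauss2) =
    (\<integral>\<^sup>+x. \<integral>\<^sup>+y. ennreal (exp (a * x)) * ennreal (exp (b * y)) \<partial>std_normal_distribution \<partial>std_normal_distribution)"
    by (subst nn_integral_fst[symmetric]) (auto simp: exp_add ennreal_mult)
  also have "\<dots> = ennreal (exp (a\<^sup>2 / 2)) * ennreal (exp (b\<^sup>2 / 2))"
    by (simp add: nn_integral_cmult nn_integral_multc std_normal_mgf)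
  finally show ?thesis by (simp add: ennreal_mult[symmetric] exp_add[symmetric] add_divide_distrib)
qed

text \<open>A point r of \<open>R\<close> describes one jump, and the same r serves all coordinates:
  \<open>A j r\<close> is the complex amplitude seen by coordinate j, and \<open>V r\<close> bounds
  all these amplitudes at once. \<open>N\<close> independent jumps are added up.\<close>

locale gaussian_mixture = prob_space R for R :: "'b measure" +
  fixes m N :: nat and A :: "nat \<Rightarrow> 'b \<Rightarrow> complex" and V :: "'b \<Rightarrow> real"
  assumes A_measurable: "\<And>j. j < m \<Longrightarrow> A j \<in> borel_measurable R"
    and V_measurable [measurable]: "V \<in> borel_measurable R"
    and A_le_V: "\<And>j r. j < m \<Longrightarrow> cmod (A j r) \<le> V r"
begin

definition atom_space :: "('b \<times> real \<times> real) measure" where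
  "atom_space = R \<Otimes>\<^sub>M gauss2"

text \<open>The two independent Gaussians make the atom depend in law only on the modulus of a linear
  combination of the \<open>A j\<close>, as isotropy of the complex stable measure requires.\<close>

definition atom :: "nat \<Rightarrow> 'b \<times> real \<times> real \<Rightarrow> real" where
  "atom j p = Re (A j (fst p)) * fst (snd p) + Im (A j (fst p)) * snd (snd p)"

definition mixture_space :: "(nat \<Rightarrow> 'b \<times> real \<times> real) measure" where
  "mixture_space = PiM {..<N} (\<lambda>_. atom_space)"

definition mixture :: "nat \<Rightarrow> (nat \<Rightarrow> 'b \<times> real \<times> real) \<Rightarrow> real" where
  "mixture j \<omega> = (\<Sum>k<N. atom j (\<omega> k))"

lemma prob_space_atom_space: "prob_space atom_space"
  unfolding atom_space_def by (intro prob_space_pair prob_space_gauss2 prob_space_axioms)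

lemma prob_space_mixture_space: "prob_space mixture_space"
  unfolding mixture_space_def by (intro prob_space_PiM prob_space_atom_space)

lemma atom_measurable:
  assumes "j < m" shows "atom j \<in> borel_measurable atom_space"
proof -
  have [measurable]: "A j \<in> borel_measurable R" using A_measurable[OF assms] .
  show ?thesis unfolding atom_def atom_space_def by measurable
qed

lemma component_measurable: "k < N \<Longrightarrow> (\<lambda>\<omega>. \<omega> k) \<in> measurable mixture_space atom_space"
  unfolding mixture_space_def by (rule measurable_component_singleton) simp

lemma mixture_measurable: "j < m \<Longrightarrow> mixture j \<in> borel_measurable mixture_space"
  unfolding mixture_def
  by (intro borel_measurable_sum measurable_compose[OF component_measurable atom_measurable]) auto

text \<open>Given r, the combination of atoms is Re B G + Im B G' with B the same combination of the
  amplitudes, hence centred Gaussian with variance |B|^2.\<close>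

lemma atom_cis:
  "(LINT p|atom_space. cis (\<Sum>j<m. u j * atom j p)) =
    complex_of_real (LINT r|R. exp (- (cmod (\<Sum>j<m. complex_of_real (u j) * A j r))\<^sup>2 / 2))"
proof -
  interpret G: prob_space gauss2 by (rule prob_space_gauss2)
  interpret T: prob_space atom_space by (rule prob_space_atom_space)
  interpret P: pair_sigma_finite R gauss2 by unfold_locales
  define B where "B = (\<lambda>r. \<Sum>j<m. complex_of_real (u j) * A j r)"
  have e: "(\<Sum>j<m. u j * atom j p) = Re (B (fst p)) * fst (snd p) + Im (B (fst p)) * snd (snd p)" for p
    by (simp add: B_def atom_def sum_distrib_right sum_distrib_left sum.distrib algebra_simps)
  have "(\<lambda>p. \<Sum>j<m. u j * atom j p) \<in> borel_measurable atom_space"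
    using atom_measurable by (intro borel_measurable_sum borel_measurable_times) auto
  from measurable_compose[OF this cis_measurable]
  have i: "integrable atom_space (\<lambda>p. cis (\<Sum>j<m. u j * atom j p))"
    by (intro T.integrable_const_bound[where B=1]) auto
  have "(LINT p|atom_space. cis (\<Sum>j<m. u j * atom j p)) =
     (LINT r|R. LINT q|gauss2. cis (Re (B r) * fst q + Im (B r) * snd q))"
    using i unfolding atom_space_def by (subst P.integral_fst'[symmetric]) (auto simp: e)
  also have "\<dots> = (LINT r|R. complex_of_real (exp (- (cmod (B r))\<^sup>2 / 2)))"
    by (simp only: gauss2_cis cmod_power2)
  finally show ?thesis by (simp only: integral_complex_of_real B_def)
qed

lemma mixture_cis:
  "(LINT \<omega>|mixture_space. cis (\<Sum>j<m. u j * mixture j \<omega>)) =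
    complex_of_real ((LINT r|R. exp (- (cmod (\<Sum>j<m. complex_of_real (u j) * A j r))\<^sup>2 / 2)) ^ N)"
proof -
  interpret T: prob_space atom_space by (rule prob_space_atom_space)
  interpret PT: product_sigma_finite "\<lambda>_. atom_space" by unfold_locales
  have "(\<lambda>p. \<Sum>j<m. u j * atom j p) \<in> borel_measurable atom_space"
    using atom_measurable by (intro borel_measurable_sum borel_measurable_times) auto
  from measurable_compose[OF this cis_measurable]
  have i: "integrable atom_space (\<lambda>p. cis (\<Sum>j<m. u j * atom j p))"
    by (intro T.integrable_const_bound[where B=1]) auto
  have cis_sum: "cis (\<Sum>k\<in>I. f k) = (\<Prod>k\<in>I. cis (f k))" if "finite I" for I :: "nat set" and f
    using that by induction (auto simp: cis_mult[symmetric])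
  have "(\<Sum>j<m. u j * mixture j \<omega>) = (\<Sum>k<N. \<Sum>j<m. u j * atom j (\<omega> k))" for \<omega>
    unfolding mixture_def sum_distrib_left by (rule sum.swap)
  then have "(LINT \<omega>|mixture_space. cis (\<Sum>j<m. u j * mixture j \<omega>)) =
     (LINT \<omega>|mixture_space. (\<Prod>k<N. cis (\<Sum>j<m. u j * atom j (\<omega> k))))"
    by (simp add: cis_sum)
  also have "\<dots> = (\<Prod>k<N. LINT p|atom_space. cis (\<Sum>j<m. u j * atom j p))"
    unfolding mixture_space_def using i by (intro PT.product_integral_prod) auto
  finally show ?thesis by (simp add: atom_cis)
qed

text \<open>Compensating by the energy inside the exponential avoids conditioning on the variances.\<close>

lemma atom_exp_supermartingale:
  assumes j: "j < m"
  shows "(\<integral>\<^sup>+p. ennreal (exp (s * atom j p - s\<^sup>2 * (V (fst p))\<^sup>2 / 2)) \<partial>atom_space) \<le> 1"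
proof -
  interpret G: prob_space gauss2 by (rule prob_space_gauss2)
  have [measurable]: "A j \<in> borel_measurable R" using A_measurable[OF j] .
  have "(\<integral>\<^sup>+p. ennreal (exp (s * atom j p - s\<^sup>2 * (V (fst p))\<^sup>2 / 2)) \<partial>atom_space) =
    (\<integral>\<^sup>+r. \<integral>\<^sup>+q. ennreal (exp (- (s\<^sup>2 * (V r)\<^sup>2 / 2))) *
      ennreal (exp ((s * Re (A j r)) * fst q + (s * Im (A j r)) * snd q)) \<partial>gauss2 \<partial>R)"
    unfolding atom_space_def atom_def
    by (subst G.nn_integral_fst[symmetric])
      (auto simp: ennreal_mult[symmetric] mult_exp_exp algebra_simps)
  also have "\<dots> = (\<integral>\<^sup>+r. ennreal (exp (- (s\<^sup>2 * (V r)\<^sup>2 / 2)))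
      * ennreal (exp (((s * Re (A j r))\<^sup>2 + (s * Im (A j r))\<^sup>2) / 2)) \<partial>R)"
  proof (rule nn_integral_cong)
    fix r
    have "(\<lambda>q. ennreal (exp (s * Re (A j r) * fst q + s * Im (A j r) * snd q))) \<in> borel_measurable gauss2"
      by measurable
    then show "(\<integral>\<^sup>+q. ennreal (exp (- (s\<^sup>2 * (V r)\<^sup>2 / 2))) *
        ennreal (exp ((s * Re (A j r)) * fst q + (s * Im (A j r)) * snd q)) \<partial>gauss2)
      = ennreal (exp (- (s\<^sup>2 * (V r)\<^sup>2 / 2)))
        * ennreal (exp (((s * Re (A j r))\<^sup>2 + (s * Im (A j r))\<^sup>2) / 2))"
      by (simp only: nn_integral_cmult gauss2_mgf)
  qed
  \<comment> \<open>The conditional variance of s times the atom is at most s^2 V^2, so the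
    compensator outweighs the Gaussian moment for every r.\<close>
  also have "\<dots> \<le> (\<integral>\<^sup>+r. 1 \<partial>R)"
  proof (rule nn_integral_mono)
    fix r
    have "(s * Re (A j r))\<^sup>2 + (s * Im (A j r))\<^sup>2 = s\<^sup>2 * (cmod (A j r))\<^sup>2"
      by (simp add: cmod_power2 power_mult_distrib algebra_simps)
    also have "\<dots> \<le> s\<^sup>2 * (V r)\<^sup>2"
      using A_le_V[OF j, of r] by (intro mult_left_mono power_mono) auto
    finally show "ennreal (exp (- (s\<^sup>2 * (V r)\<^sup>2 / 2)))
      * ennreal (exp (((s * Re (A j r))\<^sup>2 + (s * Im (A j r))\<^sup>2) / 2)) \<le> 1"
      by (simp add: ennreal_mult[symmetric] mult_exp_exp)
  qed
  also have "\<dots> = 1" by (simp add: emeasure_space_1)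
  finally show ?thesis .
qed

text \<open>Given the jumps, the conditional variance of every \<open>mixture j\<close> is at most
  this one random variable, uniformly in j.\<close>

definition energy :: "(nat \<Rightarrow> 'b \<times> real \<times> real) \<Rightarrow> real" where
  "energy \<omega> = (\<Sum>k<N. (V (fst (\<omega> k)))\<^sup>2)"

lemma energy_measurable [measurable]: "energy \<in> borel_measurable mixture_space"
proof -
  have "(\<lambda>p. (V (fst p))\<^sup>2) \<in> borel_measurable atom_space"
    unfolding atom_space_def by measurable
  from measurable_compose[OF component_measurable this] show ?thesis
    unfolding energy_def by (intro borel_measurable_sum) auto
qed

text \<open>Both exponents are additive over the independent atoms, so the expectation is the N-th
  power of a one-atom expectation that is at most 1.\<close>

lemma mixture_exp_supermartingale:
  assumes j: "j < m"
  shows "(\<integral>\<^sup>+\<omega>. ennreal (exp (s * mixture j \<omega> - s\<^sup>2 * energy \<omega> / 2)) \<partial>mixture_space) \<le> 1"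
proof -
  interpret T: prob_space atom_space by (rule prob_space_atom_space)
  interpret PT: product_sigma_finite "\<lambda>_. atom_space" by unfold_locales
  have [measurable]: "atom j \<in> borel_measurable atom_space" using atom_measurable[OF j] .
  have [measurable]: "(\<lambda>p. V (fst p)) \<in> borel_measurable atom_space"
    unfolding atom_space_def by measurable
  have "exp (s * mixture j \<omega> - s\<^sup>2 * energy \<omega> / 2) =
    (\<Prod>k<N. exp (s * atom j (\<omega> k) - s\<^sup>2 * (V (fst (\<omega> k)))\<^sup>2 / 2))" for \<omega>
    unfolding mixture_def energy_def
    by (simp add: exp_sum[symmetric] sum_subtractf sum_distrib_left sum_divide_distrib)
  then have "(\<integral>\<^sup>+\<omega>. ennreal (exp (s * mixture j \<omega> - s\<^sup>2 * energy \<omega> / 2)) \<partial>mixture_space) =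
     (\<integral>\<^sup>+\<omega>. (\<Prod>k<N. ennreal (exp (s * atom j (\<omega> k) - s\<^sup>2 * (V (fst (\<omega> k)))\<^sup>2 / 2))) \<partial>mixture_space)"
    by (simp add: prod_ennreal)
  also have "\<dots> = (\<Prod>k<N. \<integral>\<^sup>+p. ennreal (exp (s * atom j p - s\<^sup>2 * (V (fst p))\<^sup>2 / 2)) \<partial>atom_space)"
    unfolding mixture_space_def by (intro PT.product_nn_integral_prod) auto
  also have "\<dots> = (\<integral>\<^sup>+p. ennreal (exp (s * atom j p - s\<^sup>2 * (V (fst p))\<^sup>2 / 2)) \<partial>atom_space) ^ N"
    by simp
  also have "\<dots> \<le> 1"
    using power_mono_ennreal[OF atom_exp_supermartingale[OF j], of s N] by simp
  finally show ?thesis .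
qed

text \<open>A Chernoff bound restricted to the event that the energy is at most y^2. The sign
  \<sigma> lets one proof treat both tails.\<close>

lemma mixture_tail_one_sided:
  assumes j: "j < m" and y: "0 < y" and \<sigma>: "\<sigma>\<^sup>2 = 1" and l: "0 \<le> l"
  shows "measure mixture_space {\<omega> \<in> space mixture_space. \<sigma> * mixture j \<omega> > l \<and> energy \<omega> \<le> y\<^sup>2}
    \<le> exp (- l\<^sup>2 / (2 * y\<^sup>2))" (is "measure _ ?E \<le> ?b")
proof -
  interpret Q: prob_space mixture_space by (rule prob_space_mixture_space)
  have [measurable]: "mixture j \<in> borel_measurable mixture_space" using mixture_measurable[OF j] .
  \<comment> \<open>This value maximises s l - s^2 y^2 / 2; the maximum is l^2 / (2 y^2).\<close>
  define s where "s = l / y\<^sup>2"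
  have s: "0 \<le> s" using l y by (simp add: s_def)
  have "emeasure mixture_space ?E = (\<integral>\<^sup>+\<omega>. indicator ?E \<omega> \<partial>mixture_space)" by simp
  also have "\<dots> \<le> (\<integral>\<^sup>+\<omega>. ennreal ?b * ennreal (exp ((s * \<sigma>) * mixture j \<omega> - (s * \<sigma>)\<^sup>2 * energy \<omega> / 2)) \<partial>mixture_space)"
  proof (rule nn_integral_mono)
    fix \<omega>
    show "indicator ?E \<omega> \<le> ennreal ?b * ennreal (exp ((s * \<sigma>) * mixture j \<omega> - (s * \<sigma>)\<^sup>2 * energy \<omega> / 2))"
    proof (cases "\<omega> \<in> ?E")
      case True
      then have "s * l \<le> s * (\<sigma> * mixture j \<omega>)" "s\<^sup>2 * energy \<omega> \<le> s\<^sup>2 * y\<^sup>2"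
        using s by (auto intro!: mult_left_mono)
      moreover have "s * l - s\<^sup>2 * y\<^sup>2 / 2 = l\<^sup>2 / (2 * y\<^sup>2)"
        using y by (simp add: s_def field_simps power2_eq_square)
      ultimately have "0 \<le> - l\<^sup>2 / (2 * y\<^sup>2) + ((s * \<sigma>) * mixture j \<omega> - (s * \<sigma>)\<^sup>2 * energy \<omega> / 2)"
        using \<sigma> by (simp add: power_mult_distrib)
      then have "1 \<le> ?b * exp ((s * \<sigma>) * mixture j \<omega> - (s * \<sigma>)\<^sup>2 * energy \<omega> / 2)"
        unfolding mult_exp_exp by (subst one_le_exp_iff)
      then show ?thesis using True by (simp add: ennreal_mult[symmetric])
    qed simp
  qed
  also have "\<dots> = ennreal ?b * (\<integral>\<^sup>+\<omega>. ennreal (exp ((s * \<sigma>) * mixture j \<omega> - (s * \<sigma>)\<^sup>2 * energy \<omega> / 2)) \<partial>mixture_space)"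
    by (intro nn_integral_cmult) measurable
  also have "\<dots> \<le> ennreal ?b * 1"
    by (intro mult_left_mono mixture_exp_supermartingale[OF j]) auto
  finally show ?thesis by (simp add: Q.emeasure_eq_measure)
qed

text \<open>Markov's inequality is applied to 1 - exp (- energy / (2 y^2)), which is at least 1 -
  exp (-1/2) on the event. The energy itself would not do: its mean is infinite for the stable
  choice of \<open>V\<close>.\<close>

lemma energy_tail:
  assumes y: "0 < y"
  shows "measure mixture_space {\<omega> \<in> space mixture_space. energy \<omega> > y\<^sup>2}
    \<le> N * (LINT r|R. 1 - exp (- (V r)\<^sup>2 / (2 * y\<^sup>2))) / (1 - exp (- 1 / 2))" (is "measure _ ?E \<le> _")
proof -
  interpret T: prob_space atom_space by (rule prob_space_atom_space)
  interpret G: prob_space gauss2 by (rule prob_space_gauss2)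
  interpret Q: prob_space mixture_space by (rule prob_space_mixture_space)
  interpret PT: product_sigma_finite "\<lambda>_. atom_space" by unfold_locales
  interpret P: pair_sigma_finite R gauss2 by unfold_locales
  have [measurable]: "(\<lambda>p. V (fst p)) \<in> borel_measurable atom_space"
    unfolding atom_space_def by measurable
  define f where "f = (\<lambda>r. exp (- (V r)\<^sup>2 / (2 * y\<^sup>2)))"
  have [measurable]: "f \<in> borel_measurable R" unfolding f_def by measurable
  have f01: "0 \<le> f r" "f r \<le> 1" for r by (auto simp: f_def)
  define p where "p = (LINT r|R. f r)"
  have fi: "integrable R f" using f01 by (intro integrable_const_bound[where B=1]) auto
  have p01: "0 \<le> p" "p \<le> 1"
    unfolding p_def using f01 fi integral_le_const[of f 1] by (auto intro: integral_nonneg_AE)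
  have fa: "integrable atom_space (\<lambda>p. f (fst p))" unfolding f_def
    by (intro T.integrable_const_bound[where B=1]) auto
  have marg: "(LINT q|atom_space. f (fst q)) = p"
    using fa unfolding atom_space_def p_def
    by (subst P.integral_fst'[symmetric]) (auto simp: G.prob_space)
  have e: "exp (- energy \<omega> / (2 * y\<^sup>2)) = (\<Prod>k<N. f (fst (\<omega> k)))" for \<omega>
    unfolding energy_def f_def
    by (simp add: exp_sum[symmetric] sum_divide_distrib sum_negf)
  have E: "(LINT \<omega>|mixture_space. exp (- energy \<omega> / (2 * y\<^sup>2))) = p ^ N"
    unfolding e mixture_space_def
    by (subst PT.product_integral_prod) (auto simp: fa marg)
  have energy_nonneg: "0 \<le> energy \<omega>" for \<omega> unfolding energy_def by (intro sum_nonneg) auto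
  have i: "integrable mixture_space (\<lambda>\<omega>. exp (- energy \<omega> / (2 * y\<^sup>2)))"
    using energy_nonneg y by (intro Q.integrable_const_bound[where B=1]) auto
  have c: "0 < 1 - exp (- 1 / 2 :: real)" by simp
  have "measure mixture_space ?E * (1 - exp (- 1 / 2)) = (LINT \<omega>|mixture_space. indicator ?E \<omega> * (1 - exp (- 1 / 2)))"
    by simp
  also have "\<dots> \<le> (LINT \<omega>|mixture_space. 1 - exp (- energy \<omega> / (2 * y\<^sup>2)))"
  proof (rule integral_mono)
    fix \<omega>
    show "indicator ?E \<omega> * (1 - exp (- 1 / 2)) \<le> 1 - exp (- energy \<omega> / (2 * y\<^sup>2))"
      using energy_nonneg[of \<omega>] y by (auto simp: indicator_def field_simps)
  qed (use i in \<open>auto simp: Q.emeasure_eq_measure\<close>)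
  also have "\<dots> = 1 - p ^ N"
    using i E by (simp add: Q.prob_space)
  \<comment> \<open>Bernoulli's inequality replaces the N-th power by N times the one-atom defect,
    the quantity that is later bounded independently of \<open>N\<close>.\<close>
  also have "\<dots> \<le> N * (1 - p)"
    using Bernoulli_inequality[of "p - 1" N] p01 by (simp add: algebra_simps)
  also have "1 - p = (LINT r|R. 1 - f r)"
    using fi by (simp add: p_def prob_space)
  finally show ?thesis using c by (simp add: f_def pos_le_divide_eq)
qed

text \<open>The event of large energy is common to all coordinates and is charged once; only the
  Gaussian term carries the factor m.\<close>

lemma mixture_max_tail:
  assumes y: "0 < y" and l: "0 \<le> l"
  shows "measure mixture_space {\<omega> \<in> space mixture_space. \<exists>j<m. \<bar>mixture j \<omega>\<bar> > l}
    \<le> 2 * m * exp (- l\<^sup>2 / (2 * y\<^sup>2))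
      + N * (LINT r|R. 1 - exp (- (V r)\<^sup>2 / (2 * y\<^sup>2))) / (1 - exp (- 1 / 2))"
proof -
  interpret Q: prob_space mixture_space by (rule prob_space_mixture_space)
  let ?E = "\<lambda>\<sigma> j. {\<omega> \<in> space mixture_space. \<sigma> * mixture j \<omega> > l \<and> energy \<omega> \<le> y\<^sup>2}"
  let ?F = "{\<omega> \<in> space mixture_space. energy \<omega> > y\<^sup>2}"
  have Em: "?E \<sigma> j \<in> sets mixture_space" if "j < m" for \<sigma> j
  proof -
    have [measurable]: "mixture j \<in> borel_measurable mixture_space" using mixture_measurable[OF that] .
    show ?thesis by measurable
  qed
  have Fm: "?F \<in> sets mixture_space" by measurable
  have b: "measure mixture_space (\<Union>j<m. ?E \<sigma> j) \<le> m * exp (- l\<^sup>2 / (2 * y\<^sup>2))" if "\<sigma>\<^sup>2 = 1" for \<sigma>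
  proof -
    have "measure mixture_space (\<Union>j<m. ?E \<sigma> j) \<le> (\<Sum>j<m. measure mixture_space (?E \<sigma> j))"
      using Em by (intro Q.finite_measure_subadditive_finite) auto
    also have "\<dots> \<le> (\<Sum>j<m. exp (- l\<^sup>2 / (2 * y\<^sup>2)))"
      using mixture_tail_one_sided[OF _ y that l] by (intro sum_mono) auto
    finally show ?thesis by simp
  qed
  have "measure mixture_space {\<omega> \<in> space mixture_space. \<exists>j<m. \<bar>mixture j \<omega>\<bar> > l}
    \<le> measure mixture_space (((\<Union>j<m. ?E 1 j) \<union> (\<Union>j<m. ?E (-1) j)) \<union> ?F)"
    using Em[of _ 1] Em[of _ "-1"] Fm by (intro Q.finite_measure_mono sets.Un sets.finite_UN) (auto simp: abs_if split: if_splits)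
  also have "\<dots> \<le> measure mixture_space ((\<Union>j<m. ?E 1 j) \<union> (\<Union>j<m. ?E (-1) j)) + measure mixture_space ?F"
    using Em[of _ 1] Em[of _ "-1"] Fm by (intro measure_Un_le sets.Un sets.finite_UN) auto
  also have "measure mixture_space ((\<Union>j<m. ?E 1 j) \<union> (\<Union>j<m. ?E (-1) j))
    \<le> measure mixture_space (\<Union>j<m. ?E 1 j) + measure mixture_space (\<Union>j<m. ?E (-1) j)"
    using Em[of _ 1] Em[of _ "-1"] by (intro measure_Un_le sets.finite_UN) auto
  finally show ?thesis
    using b[of 1] b[of "-1"] energy_tail[OF y] by simp
qed

end

section \<open>The maximum of jointly stable variables\<close>

text \<open>For bases in [-1,1] one has |a^n - b^n| <= n |a - b|, so replacing \<open>x n\<close> by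
  its limit costs at most the distance between the two.\<close>

lemma tendsto_one_minus_power_exp:
  fixes x :: "nat \<Rightarrow> real"
  assumes x: "x \<longlonglongrightarrow> X" and x0: "\<And>n. 0 \<le> x n" and xn: "\<And>n. x n \<le> Suc n"
  shows "(\<lambda>n. (1 - x n / Suc n) ^ Suc n) \<longlonglongrightarrow> exp (- X)"
proof -
  have X0: "0 \<le> X" using LIMSEQ_le_const[OF x, of 0] x0 by auto
  have "(\<lambda>n. (1 + (- X) / Suc n) ^ Suc n) \<longlonglongrightarrow> exp (- X)"
    using tendsto_exp_limit_sequentially[of "-X"] by (rule LIMSEQ_Suc)
  moreover have "(\<lambda>n. (1 - x n / Suc n) ^ Suc n - (1 + (- X) / Suc n) ^ Suc n) \<longlonglongrightarrow> 0"
  proof (rule Lim_null_comparison)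
    show "(\<lambda>n. \<bar>x n - X\<bar>) \<longlonglongrightarrow> 0"
      using x by (simp add: LIM_zero tendsto_rabs_zero)
    show "\<forall>\<^sub>F n in sequentially. norm ((1 - x n / Suc n) ^ Suc n - (1 + (- X) / Suc n) ^ Suc n) \<le> \<bar>x n - X\<bar>"
      \<comment> \<open>For such n the base 1 - X / (n + 1) lies in [0,1], as the comparison of
        powers requires.\<close>
      using eventually_ge_at_top[of "nat \<lceil>X\<rceil>"]
    proof eventually_elim
      case (elim n)
      then have Xn: "X \<le> Suc n" by linarith
      have "norm ((1 - x n / Suc n) ^ Suc n - (1 + (- X) / Suc n) ^ Suc n)
        \<le> Suc n * norm ((1 - x n / Suc n) - (1 + (- X) / Suc n))"
        using x0[of n] xn[of n] X0 Xn by (intro norm_power_diff) (auto simp: field_simps abs_le_iff)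
      also have "(1 - x n / Suc n) - (1 + (- X) / Suc n) = (X - x n) / Suc n"
        by (simp add: diff_divide_distrib)
      also have "Suc n * norm ((X - x n) / Suc n) = \<bar>x n - X\<bar>"
        by (simp add: abs_minus_commute)
      finally show ?case .
    qed
  qed
  ultimately show ?thesis
    using tendsto_add by fastforce
qed

lemma (in prob_space) complement_indicator:
  assumes E: "E \<in> events"
  shows "integrable M (\<lambda>\<omega>. 1 - indicator E \<omega> :: real)"
    and "(LINT \<omega>|M. 1 - indicator E \<omega>) = 1 - prob E"
  using E by (simp_all add: emeasure_eq_measure prob_space)

text \<open>The bound holds for the approximating mixtures and passes to the limit in law. The free
  parameter y caps the square root of the common energy: raising it worsens the Gaussian term and
  improves the polynomial one.\<close>

lemma stable_max_tail:
  fixes M :: "'a measure" and Z :: "nat \<Rightarrow> 'a \<Rightarrow> real"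
    and g :: "nat \<Rightarrow> real \<Rightarrow> complex" and F :: "real \<Rightarrow> real"
  assumes M: "prob_space M" and \<alpha>: "0 < \<alpha>" "\<alpha> < 2"
    and Z: "\<And>j. j < m \<Longrightarrow> Z j \<in> borel_measurable M"
    and g: "\<And>j. j < m \<Longrightarrow> g j \<in> borel_measurable borel"
    and F [measurable]: "F \<in> borel_measurable borel"
    and gF: "\<And>j x. j < m \<Longrightarrow> cmod (g j x) \<le> F x"
    and Fi: "integrable lborel (\<lambda>x. F x powr \<alpha>)"
    and S: "(LBINT x. F x powr \<alpha>) = S" "0 < S"
    and char: "\<And>u. (LINT \<omega>|M. cis (\<Sum>j<m. u j * Z j \<omega>)) =
      complex_of_real (exp (- (LBINT x. cmod (\<Sum>j<m. complex_of_real (u j) * g j x) powr \<alpha>)))"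
    and l: "0 < l" and y: "0 < y"
  shows "measure M {\<omega> \<in> space M. \<exists>j<m. 2 * l \<le> \<bar>Z j \<omega>\<bar>}
    \<le> 2 * real m * exp (- l\<^sup>2 / (2 * y\<^sup>2)) + S * y powr (- \<alpha>) / (1 - exp (- 1 / 2))"
\<comment> \<open>Nonnegativity of \<open>F\<close> comes from its dominating some kernel, so at
  least one index is required.\<close>
proof (cases "m = 0")
  case True
  then show ?thesis using S y by simp
next
  case m: False
  have F0: "0 \<le> F x" for x using gF[of 0 x] m norm_ge_zero[of "g 0 x"] by (metis order_trans neq0_conv)
  interpret M: prob_space M by fact
  \<comment> \<open>The amplitude is chosen so that
    \<open>levy_mass \<alpha> * \<kappa> powr \<alpha> = S\<close>; this undoes the normalisation of
    \<open>F powr \<alpha>\<close> to a probability density.\<close>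
  define \<kappa> where "\<kappa> = (S / levy_mass \<alpha>) powr (1/\<alpha>)"
  have K: "0 < levy_mass \<alpha>" by (rule levy_mass_pos[OF \<alpha>])
  have \<kappa>: "0 < \<kappa>" using K S by (simp add: \<kappa>_def)
  have \<kappa>\<alpha>: "\<kappa> powr \<alpha> = S / levy_mass \<alpha>" using K S \<alpha> by (simp add: \<kappa>_def powr_powr)
  define D where "D = density lborel (\<lambda>x. ennreal (F x powr \<alpha> / S))"
  \<comment> \<open>\<open>Suc N\<close> keeps the interval nonempty. It is also the number of
    jumps, so the parameter w has intensity 1 on a growing interval.\<close>
  define U where "U = (\<lambda>N. density lborel (\<lambda>w. ennreal (indicator {0<..real (Suc N)} w / Suc N)))"
  have D: "prob_space D"
  proof
    have "emeasure D (space D) = (\<integral>\<^sup>+x. ennreal (F x powr \<alpha> / S) \<partial>lborel)"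
      by (simp add: D_def emeasure_density)
    also have "\<dots> = ennreal (LBINT x. F x powr \<alpha> / S)"
      using S Fi by (intro nn_integral_eq_integral) auto
    finally show "emeasure D (space D) = 1" using S by simp
  qed
  have U: "prob_space (U N)" for N
  proof
    have "emeasure (U N) (space (U N)) = (\<integral>\<^sup>+w. ennreal (indicator {0<..real (Suc N)} w / Suc N) \<partial>lborel)"
      by (simp add: U_def emeasure_density)
    also have "\<dots> = ennreal (LBINT w. indicator {0<..real (Suc N)} w / Suc N)"
      by (intro nn_integral_eq_integral) auto
    finally show "emeasure (U N) (space (U N)) = 1" by simp
  qed
  interpret D: prob_space D by (rule D)
  have U_int: "(LINT w|U N. f w) = levy_trunc \<alpha> (Suc N) a / Suc N"
    if "f = (\<lambda>w. 1 - exp (- (a\<^sup>2 * w powr (-2/\<alpha>)) / 2))" for N a and f :: "real \<Rightarrow> real"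
    unfolding U_def that levy_trunc_def[OF \<alpha>] set_lebesgue_integral_def
    by (subst integral_density) (auto simp flip: integral_divide_zero intro!: Bochner_Integration.integral_cong)
  define R where "R = (\<lambda>N. U N \<Otimes>\<^sub>M D)"
  have R: "prob_space (R N)" for N unfolding R_def by (intro prob_space_pair U D)
  have sets_D [measurable_cong, simp]: "sets D = sets borel" by (simp add: D_def)
  have sets_U [measurable_cong, simp]: "sets (U N) = sets borel" for N by (simp add: U_def)
  have sets_R [measurable_cong]: "sets (R N) = sets (borel \<Otimes>\<^sub>M borel)" for N
    unfolding R_def by (rule sets_pair_measure_cong) auto
  have R_int: "(LINT r|R N. 1 - exp (- ((a (snd r))\<^sup>2 * fst r powr (-2/\<alpha>)) / 2)) =
      (LINT x|D. levy_trunc \<alpha> (Suc N) (a x)) / Suc N"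
    if [measurable]: "a \<in> borel_measurable borel" for a N
  proof -
    interpret U: prob_space "U N" by (rule U)
    interpret R: prob_space "R N" by (rule R)
    interpret P: pair_sigma_finite "U N" D by unfold_locales
    have i: "integrable (R N) (\<lambda>r. 1 - exp (- ((a (snd r))\<^sup>2 * fst r powr (-2/\<alpha>)) / 2))"
    proof (rule R.integrable_const_bound[where B=1])
      show "(\<lambda>r. 1 - exp (- ((a (snd r))\<^sup>2 * fst r powr (-2/\<alpha>)) / 2)) \<in> borel_measurable (R N)"
        unfolding R_def by measurable
    qed auto
    have "(LINT r|R N. 1 - exp (- ((a (snd r))\<^sup>2 * fst r powr (-2/\<alpha>)) / 2)) =
      (LINT x|D. LINT w|U N. 1 - exp (- ((a x)\<^sup>2 * w powr (-2/\<alpha>)) / 2))"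
      using i unfolding R_def by (subst P.integral_snd) (auto simp: case_prod_beta')
    also have "\<dots> = (LINT x|D. levy_trunc \<alpha> (Suc N) (a x) / Suc N)"
      by (simp only: U_int)
    finally show ?thesis by simp
  qed
  \<comment> \<open>Where \<open>F\<close> vanishes so does \<open>g j\<close>, and the quotient is
    0; elsewhere it has modulus at most 1. Hence the bound \<open>V\<close> depends on the jump size
    only.\<close>
  define A where "A = (\<lambda>j (r :: real \<times> real). complex_of_real (\<kappa> * fst r powr (-1/\<alpha>)) * (g j (snd r) / complex_of_real (F (snd r))))"
  define V where "V = (\<lambda>r :: real \<times> real. \<kappa> * fst r powr (-1/\<alpha>))"
  have square_powr: "(w powr (-1/\<alpha>))\<^sup>2 = w powr (-2/\<alpha>)" for w :: real
    by (simp add: power2_eq_square powr_add[symmetric])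
  have mix: "gaussian_mixture (R N) m A V" for N
  proof -
    interpret R: prob_space "R N" by (rule R)
    show ?thesis
    proof
      show "A j \<in> borel_measurable (R N)" if "j < m" for j
      proof -
        have [measurable]: "g j \<in> borel_measurable borel" using g[OF that] .
        show ?thesis unfolding A_def by measurable
      qed
      show "V \<in> borel_measurable (R N)" unfolding V_def by measurable
      show "cmod (A j r) \<le> V r" if "j < m" for j r
      proof -
        have "cmod (g j (snd r) / complex_of_real (F (snd r))) \<le> 1"
          using gF[OF that, of "snd r"] F0[of "snd r"]
          by (cases "F (snd r) = 0") (auto simp: norm_divide divide_le_eq_1)
        then show ?thesis using \<kappa>
          unfolding A_def V_def norm_mult norm_of_real by (simp add: mult_left_le)
      qed
    qed
  qed
  define MN where "MN = (\<lambda>N. gaussian_mixture.mixture_space (R N) (Suc N))"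
  define W where "W = (\<lambda>N. gaussian_mixture.mixture (Suc N) A)"
  have MN: "prob_space (MN N)" for N
    unfolding MN_def by (rule gaussian_mixture.prob_space_mixture_space[OF mix])
  have W: "W N j \<in> borel_measurable (MN N)" if "j < m" for N j
    unfolding MN_def W_def by (rule gaussian_mixture.mixture_measurable[OF mix that])
  have lim: "(\<lambda>N. LINT \<omega>|MN N. cis (\<Sum>j<m. u j * W N j \<omega>)) \<longlonglongrightarrow> (LINT \<omega>|M. cis (\<Sum>j<m. u j * Z j \<omega>))" for u
  proof -
    define B where "B = (\<lambda>x. \<Sum>j<m. complex_of_real (u j) * g j x)"
    \<comment> \<open>The location of a jump enters only through this ratio, which is bounded by
      \<open>\<kappa> * L\<close>; the integral over the jump size is then \<open>levy_trunc\<close>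
      at \<open>a x\<close>.\<close>
    define a where "a = (\<lambda>x. \<kappa> * cmod (B x) / F x)"
    have [measurable]: "B \<in> borel_measurable borel" unfolding B_def
      using g by (intro borel_measurable_sum borel_measurable_times) auto
    have am [measurable]: "a \<in> borel_measurable borel" unfolding a_def by measurable
    have a0: "0 \<le> a x" for x using \<kappa> F0[of x] by (simp add: a_def)
    define L where "L = (\<Sum>j<m. \<bar>u j\<bar>)"
    have BF: "cmod (B x) \<le> L * F x" for x
      unfolding B_def L_def sum_distrib_right
      by (intro sum_norm_le) (use gF in \<open>auto simp: norm_mult intro!: mult_left_mono\<close>)
    have aL: "a x \<le> \<kappa> * L" for x
    proof (cases "F x = 0")
      case False
      then show ?thesis using BF[of x] F0[of x] \<kappa> by (simp add: a_def field_simps)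
    qed (use \<kappa> in \<open>simp add: a_def L_def sum_nonneg\<close>)
    have *: "(LINT r|R N. exp (- (cmod (\<Sum>j<m. complex_of_real (u j) * A j r))\<^sup>2 / 2)) =
      1 - (LINT x|D. levy_trunc \<alpha> (Suc N) (a x)) / Suc N" for N
    proof -
      interpret R: prob_space "R N" by (rule R)
      have e: "(cmod (\<Sum>j<m. complex_of_real (u j) * A j r))\<^sup>2 = (a (snd r))\<^sup>2 * fst r powr (-2/\<alpha>)" for r
      proof -
        have "(\<Sum>j<m. complex_of_real (u j) * A j r) =
          complex_of_real (\<kappa> * fst r powr (-1/\<alpha>)) * (B (snd r) / complex_of_real (F (snd r)))"
          unfolding A_def B_def sum_divide_distrib sum_distrib_left by (simp add: mult_ac)
        then show ?thesis
          by (simp add: norm_mult norm_divide power_mult_distrib power_divide square_powr[simplified] a_def)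
      qed
      have "integrable (R N) (\<lambda>r. exp (- ((a (snd r))\<^sup>2 * fst r powr (-2/\<alpha>)) / 2))"
      proof (rule R.integrable_const_bound[where B=1])
        show "(\<lambda>r. exp (- ((a (snd r))\<^sup>2 * fst r powr (-2/\<alpha>)) / 2)) \<in> borel_measurable (R N)"
          by measurable
      qed auto
      then show ?thesis unfolding e R_int[OF am, symmetric] by (simp add: R.prob_space)
    qed
    have t: "(\<lambda>N. LINT x|D. levy_trunc \<alpha> (Suc N) (a x)) \<longlonglongrightarrow> (LINT x|D. levy_mass \<alpha> * a x powr \<alpha>)"
    proof (rule integral_dominated_convergence)
      show "integrable D (\<lambda>x. levy_mass \<alpha> * (\<kappa> * L) powr \<alpha>)" by simp
      show "AE x in D. (\<lambda>N. levy_trunc \<alpha> (Suc N) (a x)) \<longlonglongrightarrow> levy_mass \<alpha> * a x powr \<alpha>"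
        using levy_trunc_tendsto[OF \<alpha> a0] by (intro AE_I2 LIMSEQ_Suc)
      fix N
      show "AE x in D. norm (levy_trunc \<alpha> (Suc N) (a x)) \<le> levy_mass \<alpha> * (\<kappa> * L) powr \<alpha>"
      proof (rule AE_I2)
        fix x
        have "levy_trunc \<alpha> (Suc N) (a x) \<le> levy_mass \<alpha> * a x powr \<alpha>"
          by (rule levy_trunc_bounds(2)[OF \<alpha> a0])
        also have "\<dots> \<le> levy_mass \<alpha> * (\<kappa> * L) powr \<alpha>"
          using K aL[of x] a0[of x] \<alpha> by (intro mult_left_mono powr_mono2) auto
        finally show "norm (levy_trunc \<alpha> (Suc N) (a x)) \<le> levy_mass \<alpha> * (\<kappa> * L) powr \<alpha>"
          using levy_trunc_bounds(1)[OF \<alpha> a0, of "Suc N" x] by simp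
      qed
    qed (use levy_trunc_measurable[OF \<alpha>] in measurable)
    have "(LINT x|D. levy_mass \<alpha> * a x powr \<alpha>) = (LBINT x. F x powr \<alpha> / S * (levy_mass \<alpha> * a x powr \<alpha>))"
      unfolding D_def using S by (subst integral_density) auto
    \<comment> \<open>The density F^\<alpha> / S cancels the denominator of \<open>a\<close>, and
      \<kappa> cancels S. At zeros of \<open>F\<close> the combination \<open>B\<close> vanishes as
      well.\<close>
    also have "\<dots> = (LBINT x. cmod (B x) powr \<alpha>)"
    proof (intro Bochner_Integration.integral_cong refl)
      fix x
      show "F x powr \<alpha> / S * (levy_mass \<alpha> * a x powr \<alpha>) = cmod (B x) powr \<alpha>"
      proof (cases "F x = 0")
        case True
        then show ?thesis using BF[of x] by simp
      next
        case False
        then have "a x powr \<alpha> = \<kappa> powr \<alpha> * cmod (B x) powr \<alpha> / F x powr \<alpha>"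
          using \<kappa> F0[of x] by (simp add: a_def powr_mult powr_divide)
        then show ?thesis using False F0[of x] K S by (simp add: \<kappa>\<alpha>)
      qed
    qed
    finally have l: "(LINT x|D. levy_mass \<alpha> * a x powr \<alpha>) = (LBINT x. cmod (B x) powr \<alpha>)" .
    have b0: "0 \<le> (LINT x|D. levy_trunc \<alpha> (Suc N) (a x))" for N
      using levy_trunc_bounds(1)[OF \<alpha> a0] by (intro integral_nonneg_AE AE_I2)
    have b1: "(LINT x|D. levy_trunc \<alpha> (Suc N) (a x)) \<le> Suc N" for N
    proof -
      have [measurable]: "levy_trunc \<alpha> (Suc N) \<in> borel_measurable borel" by (rule levy_trunc_measurable[OF \<alpha>])
      have "integrable D (\<lambda>x. levy_trunc \<alpha> (Suc N) (a x))"
        using levy_trunc_bounds(1,3)[OF \<alpha> a0, of "Suc N"]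
        by (intro D.integrable_const_bound[where B="Suc N"]) auto
      then show ?thesis
        using levy_trunc_bounds(3)[OF \<alpha> a0, of "Suc N"] by (intro D.integral_le_const) auto
    qed
    have "(\<lambda>N. (1 - (LINT x|D. levy_trunc \<alpha> (Suc N) (a x)) / Suc N) ^ Suc N) \<longlonglongrightarrow> exp (- (LBINT x. cmod (B x) powr \<alpha>))"
      using t b0 b1 unfolding l by (rule tendsto_one_minus_power_exp)
    then have "(\<lambda>N. complex_of_real ((1 - (LINT x|D. levy_trunc \<alpha> (Suc N) (a x)) / Suc N) ^ Suc N))
      \<longlonglongrightarrow> complex_of_real (exp (- (LBINT x. cmod (B x) powr \<alpha>)))"
      by (rule tendsto_of_real)
    then show ?thesis
      unfolding char MN_def W_def gaussian_mixture.mixture_cis[OF mix] * B_def .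
  qed
  define b where "b = 2 * m * exp (- l\<^sup>2 / (2 * y\<^sup>2)) + S * y powr (- \<alpha>) / (1 - exp (- 1 / 2))"
  have tail: "measure (MN N) {\<omega> \<in> space (MN N). \<exists>j<m. \<bar>W N j \<omega>\<bar> > l} \<le> b" for N
  proof -
    have e: "(V r)\<^sup>2 / (2 * y\<^sup>2) = ((\<kappa> / y)\<^sup>2 * fst r powr (-2/\<alpha>)) / 2" for r
      by (simp add: V_def power_mult_distrib power_divide square_powr[simplified])
    \<comment> \<open>The factor \<open>Suc N\<close> cancels the height of the uniform density,
      leaving a truncated integral whose full value S y^(-\<alpha>) bounds it for every
      \<open>N\<close>.\<close>
    have "real (Suc N) * (LINT r|R N. 1 - exp (- (V r)\<^sup>2 / (2 * y\<^sup>2))) = levy_trunc \<alpha> (Suc N) (\<kappa> / y)"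
      using R_int[of "\<lambda>_. \<kappa> / y" N] by (simp add: e D.prob_space)
    also have "\<dots> \<le> levy_mass \<alpha> * (\<kappa> / y) powr \<alpha>"
      using \<kappa> y by (intro levy_trunc_bounds(2)[OF \<alpha>]) auto
    also have "\<dots> = S * y powr (- \<alpha>)"
      using \<kappa> y K by (simp add: powr_divide \<kappa>\<alpha> powr_minus_divide)
    finally have "real (Suc N) * (LINT r|R N. 1 - exp (- (V r)\<^sup>2 / (2 * y\<^sup>2))) / (1 - exp (- 1 / 2))
      \<le> S * y powr (- \<alpha>) / (1 - exp (- 1 / 2))"
      by (rule divide_right_mono) auto
    then show ?thesis
      unfolding MN_def W_def b_def
      using gaussian_mixture.mixture_max_tail[OF mix y less_imp_le[OF l], of N "Suc N"] by simp
  qed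
  have prod01: "0 \<le> (\<Prod>j<m. trapezoid (f j))" "(\<Prod>j<m. trapezoid (f j)) \<le> 1" for f
    using trapezoid_bounds by (auto intro!: prod_nonneg prod_le_1)
  \<comment> \<open>All frequencies are 0, which removes the oscillating factor and leaves the
    cutoffs at scale l.\<close>
  have "(\<lambda>N. LINT \<omega>|MN N. complex_of_real (\<Prod>j<m. trapezoid (W N j \<omega> / l)) * cis (\<Sum>j<m. 0 * (W N j \<omega> / l)))
    \<longlonglongrightarrow> (LINT \<omega>|M. complex_of_real (\<Prod>j<m. trapezoid (Z j \<omega> / l)) * cis (\<Sum>j<m. 0 * (Z j \<omega> / l)))"
  proof (rule trapezoid_product_tendsto[OF M MN])
    show "(\<lambda>N. LINT \<omega>|MN N. cis (\<Sum>j<m. u j * (W N j \<omega> / l))) \<longlonglongrightarrow> (LINT \<omega>|M. cis (\<Sum>j<m. u j * (Z j \<omega> / l)))" for u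
      using lim[of "\<lambda>j. u j / l"] by simp
  qed (use Z W in auto)
  then have conv: "(\<lambda>N. LINT \<omega>|MN N. (\<Prod>j<m. trapezoid (W N j \<omega> / l))) \<longlonglongrightarrow> (LINT \<omega>|M. (\<Prod>j<m. trapezoid (Z j \<omega> / l)))"
    by (simp add: tendsto_of_real_iff del: of_real_prod)
  have meas_prod: "(\<lambda>\<omega>. \<Prod>j<m. trapezoid (Y j \<omega> / l)) \<in> borel_measurable Q"
    if Y: "\<And>j. j < m \<Longrightarrow> Y j \<in> borel_measurable Q" for Q :: "'c measure" and Y :: "nat \<Rightarrow> 'c \<Rightarrow> real"
    using Y by (intro borel_measurable_prod measurable_compose[OF _ trapezoid_measurable] borel_measurable_divide) auto
  have int_prod: "integrable Q (\<lambda>\<omega>. \<Prod>j<m. trapezoid (Y j \<omega> / l))"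
    if Q: "prob_space Q" and Y: "\<And>j. j < m \<Longrightarrow> Y j \<in> borel_measurable Q" for Q :: "'c measure" and Y :: "nat \<Rightarrow> 'c \<Rightarrow> real"
  proof -
    interpret prob_space Q by fact
    show ?thesis using prod01 by (intro integrable_const_bound[where B=1] meas_prod Y) auto
  qed
  \<comment> \<open>For the approximations the cutoffs are 1 when all coordinates are at most l in
    modulus; for the limit they vanish once one coordinate reaches 2 l. This sandwich is behind the
    two thresholds.\<close>
  have lower: "1 - b \<le> (LINT \<omega>|MN N. (\<Prod>j<m. trapezoid (W N j \<omega> / l)))" for N
  proof -
    interpret Q: prob_space "MN N" by (rule MN)
    let ?E = "{\<omega> \<in> space (MN N). \<exists>j<m. \<bar>W N j \<omega>\<bar> > l}"
    have "?E = (\<Union>j<m. {\<omega> \<in> space (MN N). \<bar>W N j \<omega>\<bar> > l})" by auto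
    also have "\<dots> \<in> sets (MN N)"
    proof (intro sets.finite_UN)
      fix j assume "j \<in> {..<m}"
      then have [measurable]: "W N j \<in> borel_measurable (MN N)" using W by simp
      show "{\<omega> \<in> space (MN N). \<bar>W N j \<omega>\<bar> > l} \<in> sets (MN N)" by measurable
    qed simp
    finally have E [measurable]: "?E \<in> sets (MN N)" .
    have "1 - b \<le> 1 - measure (MN N) ?E" using tail[of N] by simp
    also have "\<dots> = (LINT \<omega>|MN N. 1 - indicator ?E \<omega>)"
      by (rule Q.complement_indicator(2)[OF E, symmetric])
    also have "\<dots> \<le> (LINT \<omega>|MN N. (\<Prod>j<m. trapezoid (W N j \<omega> / l)))"
    proof (rule integral_mono)
      fix \<omega> assume \<omega>: "\<omega> \<in> space (MN N)"
      show "1 - indicator ?E \<omega> \<le> (\<Prod>j<m. trapezoid (W N j \<omega> / l))"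
      proof (cases "\<omega> \<in> ?E")
        case False
        have "trapezoid (W N j \<omega> / l) = 1" if "j < m" for j
        proof -
          have "\<not> \<bar>W N j \<omega>\<bar> > l" using False that \<omega> by blast
          then show ?thesis using l by (intro trapezoid_inner) (simp add: not_less)
        qed
        then show ?thesis using False by simp
      qed (use prod01 in simp)
    qed (rule Q.complement_indicator(1)[OF E] int_prod[OF MN W], assumption?)+
    finally show ?thesis .
  qed
  let ?E = "{\<omega> \<in> space M. \<exists>j<m. 2 * l \<le> \<bar>Z j \<omega>\<bar>}"
  have "?E = (\<Union>j<m. {\<omega> \<in> space M. 2 * l \<le> \<bar>Z j \<omega>\<bar>})" by auto
  also have "\<dots> \<in> sets M"
  proof (intro sets.finite_UN)
    fix j assume "j \<in> {..<m}"
    then have [measurable]: "Z j \<in> borel_measurable M" using Z by simp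
    show "{\<omega> \<in> space M. 2 * l \<le> \<bar>Z j \<omega>\<bar>} \<in> sets M" by measurable
  qed simp
  finally have E [measurable]: "?E \<in> sets M" .
  have "1 - b \<le> (LINT \<omega>|M. (\<Prod>j<m. trapezoid (Z j \<omega> / l)))"
    using LIMSEQ_le_const[OF conv] lower by auto
  also have "\<dots> \<le> (LINT \<omega>|M. 1 - indicator ?E \<omega>)"
  proof (rule integral_mono)
    fix \<omega> assume \<omega>: "\<omega> \<in> space M"
    show "(\<Prod>j<m. trapezoid (Z j \<omega> / l)) \<le> 1 - indicator ?E \<omega>"
    proof (cases "\<omega> \<in> ?E")
      case True
      then obtain j where j: "j < m" "2 * l \<le> \<bar>Z j \<omega>\<bar>" by auto
      then have "trapezoid (Z j \<omega> / l) = 0" using l by (intro trapezoid_outer) (simp add: field_simps)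
      then have z: "(\<Prod>j<m. trapezoid (Z j \<omega> / l)) = 0" using j by (intro prod_zero) auto
      show ?thesis unfolding z using True by simp
    qed (use prod01 in simp)
  qed (rule M.complement_indicator(1)[OF E] int_prod[OF M Z], assumption?)+
  also have "\<dots> = 1 - measure M ?E" by (rule M.complement_indicator(2)[OF E])
  finally show ?thesis unfolding b_def by simp
qed

section \<open>Majorants of the kernel increments\<close>

lemma norm_cis_diff_le: "cmod (cis u - cis v) \<le> min 2 \<bar>u - v\<bar>"
proof -
  have "cmod (cis u - cis v) = cmod (cis v * (cis (u - v) - 1))"
    by (simp add: algebra_simps cis_mult)
  also have "\<dots> = cmod (cis (u - v) - 1)" by (simp add: norm_mult)
  finally have e: "cmod (cis u - cis v) = cmod (cis (u - v) - 1)" .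
  have "(cmod (cis (u - v) - 1))\<^sup>2 = 2 * (1 - cos (u - v))"
    using sin_cos_squared_add[of "u - v"]
    by (simp add: cmod_power2 power2_diff algebra_simps)
  also have "\<dots> \<le> \<bar>u - v\<bar>\<^sup>2" using one_minus_cos_le[of "u - v"] by simp
  finally have "cmod (cis (u - v) - 1) \<le> \<bar>u - v\<bar>" by (rule power2_le_imp_le) simp
  moreover have "cmod (cis (u - v) - 1) \<le> 2"
    using norm_triangle_ineq4[of "cis (u - v)" 1] by simp
  ultimately show ?thesis using e by simp
qed

text \<open>Majorant of |e^(iux) - e^(ivx)| |x|^(-1/\<alpha> - h) for |u - v| <= \<tau>.\<close>

definition kernel_dom :: "real \<Rightarrow> real \<Rightarrow> real \<Rightarrow> real \<Rightarrow> real" where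
  "kernel_dom \<alpha> h \<tau> x = min 2 (\<tau> * \<bar>x\<bar>) * \<bar>x\<bar> powr (- (1/\<alpha> + h))"

definition kernel_mass :: "real \<Rightarrow> real \<Rightarrow> real" where
  "kernel_mass \<alpha> h = (LBINT x. kernel_dom \<alpha> h 1 x powr \<alpha>)"

lemma kernel_dom_nonneg: "0 \<le> \<tau> \<Longrightarrow> 0 \<le> kernel_dom \<alpha> h \<tau> x"
  by (simp add: kernel_dom_def)

lemma kernel_dom_measurable [measurable]: "kernel_dom \<alpha> h \<tau> \<in> borel_measurable borel"
  unfolding kernel_dom_def by measurable

text \<open>Near 0 the integrand is |x|^(\<alpha> - 1 - \<alpha> h), integrable since h < 1; at
  infinity it is at most a multiple of |x|^(-1 - \<alpha> h), integrable since h > 0.\<close>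

lemma integrable_kernel_dom_unit:
  assumes \<alpha>: "0 < \<alpha>" and h: "0 < h" "h < 1"
  shows "integrable lborel (\<lambda>x. kernel_dom \<alpha> h 1 x powr \<alpha>)"
proof -
  define B where "B = (\<lambda>x::real. indicator {0..1} x *\<^sub>R (x powr (\<alpha> - 1 - \<alpha> * h))
    + 2 powr \<alpha> * (indicator {1..} x *\<^sub>R (x powr (- 1 - \<alpha> * h))))"
  have "\<alpha> * h < \<alpha>" using \<alpha> h by simp
  then have B: "integrable lborel B"
    unfolding B_def
    by (intro Bochner_Integration.integrable_add integrable_mult_right
        set_integrable_powr_at_0[unfolded set_integrable_def] set_integrable_powr_at_infinity[unfolded set_integrable_def])
      (use \<alpha> h in auto)
  \<comment> \<open>\<open>B\<close> lives on the nonnegative half-line; its reflection covers the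
    other one.\<close>
  have B': "integrable lborel (\<lambda>x. B (0 + (-1) * x))"
    using B by (rule lborel_integrable_real_affine) simp
  have B0: "0 \<le> B x" for x by (auto simp: B_def indicator_def)
  have le: "kernel_dom \<alpha> h 1 x powr \<alpha> \<le> B \<bar>x\<bar>" for x
  proof (cases "x = 0")
    case False
    then have x: "0 < \<bar>x\<bar>" by simp
    have e: "(\<bar>x\<bar> powr (- (1/\<alpha> + h))) powr \<alpha> = \<bar>x\<bar> powr (- 1 - \<alpha> * h)"
    proof -
      have "- (1/\<alpha> + h) * \<alpha> = - 1 - \<alpha> * h" using \<alpha> by (simp add: algebra_simps)
      then show ?thesis by (simp only: powr_powr)
    qed
    show ?thesis
    proof (cases "\<bar>x\<bar> \<le> 1")
      case True
      then have "kernel_dom \<alpha> h 1 x powr \<alpha> = \<bar>x\<bar> powr \<alpha> * \<bar>x\<bar> powr (- 1 - \<alpha> * h)"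
        unfolding kernel_dom_def by (simp add: powr_mult flip: e)
      also have "\<dots> = \<bar>x\<bar> powr (\<alpha> - 1 - \<alpha> * h)"
        by (simp add: algebra_simps flip: powr_add)
      finally show ?thesis using True by (simp add: B_def)
    next
      case False
      have "kernel_dom \<alpha> h 1 x powr \<alpha> = (min 2 \<bar>x\<bar>) powr \<alpha> * \<bar>x\<bar> powr (- 1 - \<alpha> * h)"
        unfolding kernel_dom_def by (simp add: powr_mult flip: e)
      also have "\<dots> \<le> 2 powr \<alpha> * \<bar>x\<bar> powr (- 1 - \<alpha> * h)"
        using \<alpha> by (intro mult_right_mono powr_mono2) auto
      finally show ?thesis using False by (simp add: B_def)
    qed
  qed (use B0[of 0] in \<open>simp add: kernel_dom_def\<close>)
  show ?thesis
  proof (rule Bochner_Integration.integrable_bound[OF Bochner_Integration.integrable_add[OF B B']])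
    show "AE x in lborel. norm (kernel_dom \<alpha> h 1 x powr \<alpha>) \<le> norm (B x + B (0 + (-1) * x))"
    proof (rule AE_I2)
      fix x
      show "norm (kernel_dom \<alpha> h 1 x powr \<alpha>) \<le> norm (B x + B (0 + (-1) * x))"
        using le[of x] B0[of x] B0[of "-x"] by (cases "0 \<le> x") auto
    qed
  qed measurable
qed

text \<open>Self-similarity: the substitution of \<tau> x for x reduces lag \<tau> to lag 1 and
  produces \<tau>^(\<alpha> h). This is the source of the power of the lag in the modulus.\<close>

lemma kernel_dom_scaled:
  assumes \<alpha>: "0 < \<alpha>" and h: "0 < h" "h < 1" and \<tau>: "0 < \<tau>"
  shows "integrable lborel (\<lambda>x. kernel_dom \<alpha> h \<tau> x powr \<alpha>)"
    and "(LBINT x. kernel_dom \<alpha> h \<tau> x powr \<alpha>) = \<tau> powr (\<alpha> * h) * kernel_mass \<alpha> h"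
proof -
  have e: "kernel_dom \<alpha> h \<tau> x powr \<alpha> = \<tau> powr (1 + \<alpha> * h) * kernel_dom \<alpha> h 1 (0 + \<tau> * x) powr \<alpha>" for x
  proof -
    have "\<tau> powr (1/\<alpha> + h) * \<tau> powr (- (1/\<alpha> + h)) = 1"
      using \<tau> by (simp flip: powr_add)
    moreover have "(\<tau> * \<bar>x\<bar>) powr (- (1/\<alpha> + h)) = \<tau> powr (- (1/\<alpha> + h)) * \<bar>x\<bar> powr (- (1/\<alpha> + h))"
      by (rule powr_mult)
    ultimately have "\<tau> powr (1/\<alpha> + h) * (\<tau> * \<bar>x\<bar>) powr (- (1/\<alpha> + h)) = \<bar>x\<bar> powr (- (1/\<alpha> + h))"
      by (simp only: mult.assoc[symmetric] mult_1_left)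
    then have "kernel_dom \<alpha> h \<tau> x = \<tau> powr (1/\<alpha> + h) * kernel_dom \<alpha> h 1 (0 + \<tau> * x)"
      using \<tau> by (simp only: kernel_dom_def abs_mult add_0_left mult_1_left abs_of_pos)
        (metis mult.left_commute)
    then have "kernel_dom \<alpha> h \<tau> x powr \<alpha> = (\<tau> powr (1/\<alpha> + h)) powr \<alpha> * kernel_dom \<alpha> h 1 (0 + \<tau> * x) powr \<alpha>"
      by (simp add: powr_mult kernel_dom_nonneg)
    then show ?thesis using \<alpha> by (simp add: powr_powr algebra_simps)
  qed
  have i: "integrable lborel (\<lambda>x. kernel_dom \<alpha> h 1 (0 + \<tau> * x) powr \<alpha>)"
    using \<tau> by (intro lborel_integrable_real_affine[OF integrable_kernel_dom_unit[OF \<alpha> h], of \<tau> 0]) auto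
  then show "integrable lborel (\<lambda>x. kernel_dom \<alpha> h \<tau> x powr \<alpha>)"
    unfolding e by (rule integrable_mult_right)
  have "kernel_mass \<alpha> h = \<bar>\<tau>\<bar> *\<^sub>R (LBINT x. kernel_dom \<alpha> h 1 (0 + \<tau> * x) powr \<alpha>)"
    unfolding kernel_mass_def using \<tau> by (intro lborel_integral_real_affine) auto
  then show "(LBINT x. kernel_dom \<alpha> h \<tau> x powr \<alpha>) = \<tau> powr (\<alpha> * h) * kernel_mass \<alpha> h"
    unfolding e integral_mult_right_zero using \<tau> by (simp add: powr_add)
qed

lemma kernel_mass_nonneg: "0 \<le> kernel_mass \<alpha> h"
  unfolding kernel_mass_def by (intro integral_nonneg_AE) auto

text \<open>The exponent varies with the time point; the two extreme powers dominate all
  intermediate ones, so one majorant serves all times.\<close>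

lemma powr_minus_between:
  fixes y :: real
  assumes "0 < y" "a \<le> p" "p \<le> b"
  shows "y powr (- p) \<le> y powr (- a) + y powr (- b)"
proof (cases "1 \<le> y")
  case True
  then have "y powr (- p) \<le> y powr (- a)" using assms by (intro powr_mono) auto
  then show ?thesis using powr_ge_zero[of y "-b"] by linarith
next
  case False
  then have "y powr (- p) \<le> y powr (- b)" using assms by (intro powr_mono') auto
  then show ?thesis using powr_ge_zero[of y "-a"] by linarith
qed

text \<open>Varying the exponent produces a factor |ln y|, and \<eta> |ln y| is at most y^\<eta> or
  y^(-\<eta>), according to the side of 1. The exponent range [a,b] is therefore widened by \<eta>
  at both ends.\<close>

lemma powr_minus_diff_le:
  fixes y :: real
  assumes y: "0 < y" and p: "a \<le> p" "p \<le> b" and q: "a \<le> q" "q \<le> b" and \<eta>: "0 < \<eta>"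
  shows "\<bar>y powr (- p) - y powr (- q)\<bar> \<le> \<bar>p - q\<bar> / \<eta> * (y powr (- (a - \<eta>)) + y powr (- (b + \<eta>)))"
proof -
  define L where "L = ln y"
  have yp: "y powr c = exp (c * L)" for c using y by (simp add: powr_def L_def)
  have main: "y powr (- p) - y powr (- q) \<le> \<bar>p - q\<bar> / \<eta> * (y powr (- (a - \<eta>)) + y powr (- (b + \<eta>)))"
    if p: "a \<le> p" "p \<le> b" for p q
  proof -
    \<comment> \<open>The tangent of exp gives a one-sided bound; the other side follows by
      exchanging p and q.\<close>
    have "exp (- p * L) * (1 + (p - q) * L) \<le> exp (- p * L) * exp ((p - q) * L)"
      using exp_ge_add_one_self[of "(p - q) * L"] by (intro mult_left_mono) auto
    also have "\<dots> = exp (- q * L)" by (simp add: mult_exp_exp algebra_simps)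
    finally have "exp (- p * L) - exp (- q * L) \<le> - (p - q) * L * exp (- p * L)"
      by (simp add: algebra_simps)
    also have "\<dots> \<le> \<bar>- (p - q) * L\<bar> * exp (- p * L)" by (intro mult_right_mono) auto
    also have "\<dots> = \<bar>p - q\<bar> * (\<bar>L\<bar> * exp (- p * L))" by (simp only: abs_mult abs_minus_cancel mult.assoc)
    also have "\<dots> \<le> \<bar>p - q\<bar> * ((exp (- (a - \<eta>) * L) + exp (- (b + \<eta>) * L)) / \<eta>)"
    proof (rule mult_left_mono)
      have "\<eta> * \<bar>L\<bar> \<le> exp (\<eta> * \<bar>L\<bar>)" using exp_ge_add_one_self[of "\<eta> * \<bar>L\<bar>"] by linarith
      then have "\<eta> * \<bar>L\<bar> * exp (- p * L) \<le> exp (\<eta> * \<bar>L\<bar>) * exp (- p * L)"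
        by (intro mult_right_mono) auto
      also have "\<dots> \<le> exp (- (a - \<eta>) * L) + exp (- (b + \<eta>) * L)"
      proof (cases "0 \<le> L")
        case True
        then have "a * L \<le> p * L" using p by (intro mult_right_mono)
        then have "exp (\<eta> * \<bar>L\<bar>) * exp (- p * L) \<le> exp (- (a - \<eta>) * L)"
          using True by (simp add: mult_exp_exp algebra_simps)
        then show ?thesis by (simp add: add_increasing2)
      next
        case False
        then have "b * L \<le> p * L" using p by (intro mult_right_mono_neg) auto
        then have "exp (\<eta> * \<bar>L\<bar>) * exp (- p * L) \<le> exp (- (b + \<eta>) * L)"
          using False by (simp add: mult_exp_exp algebra_simps)
        then show ?thesis by (simp add: add_increasing)
      qed
      finally show "\<bar>L\<bar> * exp (- p * L) \<le> (exp (- (a - \<eta>) * L) + exp (- (b + \<eta>) * L)) / \<eta>"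
        using \<eta> by (simp add: pos_le_divide_eq mult_ac)
    qed simp
    finally show ?thesis unfolding yp by simp
  qed
  from main[OF p, of q] main[OF q, of p] show ?thesis
    by (simp add: abs_le_iff abs_minus_commute)
qed

text \<open>The increment splits into a change of exponent with the phase at t kept, and a change of
  phase with the exponent at s kept. The bound depends on the two times only through horizon, lag
  and \<open>D\<close>, so it is common to all increments.\<close>

lemma rhmsp_kernel_diff_le:
  assumes t: "0 \<le> t" "t \<le> T" and ts: "\<bar>t - s\<bar> \<le> \<delta>" and \<eta>: "0 < \<eta>"
    and Ht: "a \<le> H t" "H t \<le> b" and Hs: "a \<le> H s" "H s \<le> b" and D: "\<bar>H t - H s\<bar> \<le> D"
  shows "cmod (rhmsp_kernel \<alpha> H t x - rhmsp_kernel \<alpha> H s x) \<le>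
    kernel_dom \<alpha> a \<delta> x + kernel_dom \<alpha> b \<delta> x
    + D / \<eta> * (kernel_dom \<alpha> (a - \<eta>) T x + kernel_dom \<alpha> (b + \<eta>) T x)"
proof (cases "x = 0")
  case True
  then show ?thesis by (simp add: rhmsp_kernel_def kernel_dom_def)
next
  case False
  define y where "y = \<bar>x\<bar>"
  have y: "0 < y" using False by (simp add: y_def)
  define r where "r = y powr (- (1/\<alpha>))"
  have r: "0 \<le> r" by (simp add: r_def)
  have split: "y powr (- (1/\<alpha> + h)) = r * y powr (- h)" for h
    using y by (simp add: r_def flip: powr_add)
  have k: "rhmsp_kernel \<alpha> H u x = (cis (u * x) - 1) * complex_of_real (r * y powr (- H u))" for u
  proof -
    have "complex_of_real (r * y powr (- H u)) = inverse (complex_of_real (y powr (1/\<alpha> + H u)))"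
      unfolding split[symmetric] by (simp only: powr_minus of_real_inverse)
    then show ?thesis unfolding rhmsp_kernel_def y_def by (simp only: divide_inverse[of "cis _ - 1"])
  qed
  have "rhmsp_kernel \<alpha> H t x - rhmsp_kernel \<alpha> H s x =
    (cis (t * x) - 1) * complex_of_real (r * (y powr (- H t) - y powr (- H s)))
    + (cis (t * x) - cis (s * x)) * complex_of_real (r * y powr (- H s))"
    unfolding k by (simp add: algebra_simps)
  also have "cmod \<dots> \<le> cmod (cis (t * x) - cis 0) * (r * \<bar>y powr (- H t) - y powr (- H s)\<bar>)
    + cmod (cis (t * x) - cis (s * x)) * (r * y powr (- H s))"
    using r by (intro order_trans[OF norm_triangle_ineq])
      (simp add: norm_mult norm_of_real abs_mult del: of_real_diff of_real_mult)
  also have "\<dots> \<le> min 2 (T * y) * (r * (D / \<eta> * (y powr (- (a - \<eta>)) + y powr (- (b + \<eta>)))))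
    + min 2 (\<delta> * y) * (r * (y powr (- a) + y powr (- b)))"
  proof (intro add_mono mult_mono)
    have "cmod (cis (t * x) - cis 0) \<le> min 2 (t * y)"
      using norm_cis_diff_le[of "t * x" 0] t by (simp add: abs_mult y_def)
    also have "\<dots> \<le> min 2 (T * y)" using t y by (intro min.mono mult_right_mono) auto
    finally show "cmod (cis (t * x) - cis 0) \<le> min 2 (T * y)" .
    have "cmod (cis (t * x) - cis (s * x)) \<le> min 2 (\<bar>t - s\<bar> * y)"
      using norm_cis_diff_le[of "t * x" "s * x"] by (simp add: y_def flip: left_diff_distrib abs_mult)
    also have "\<dots> \<le> min 2 (\<delta> * y)" using ts y by (intro min.mono mult_right_mono) auto
    finally show "cmod (cis (t * x) - cis (s * x)) \<le> min 2 (\<delta> * y)" .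
    show "y powr (- H s) \<le> y powr (- a) + y powr (- b)"
      by (rule powr_minus_between[OF y Hs])
    have "\<bar>y powr (- H t) - y powr (- H s)\<bar> \<le> \<bar>H t - H s\<bar> / \<eta> * (y powr (- (a - \<eta>)) + y powr (- (b + \<eta>)))"
      by (rule powr_minus_diff_le[OF y Ht Hs \<eta>])
    also have "\<dots> \<le> D / \<eta> * (y powr (- (a - \<eta>)) + y powr (- (b + \<eta>)))"
      using D \<eta> by (intro mult_right_mono divide_right_mono) auto
    finally show "\<bar>y powr (- H t) - y powr (- H s)\<bar> \<le> D / \<eta> * (y powr (- (a - \<eta>)) + y powr (- (b + \<eta>)))" .
  qed (use r t ts y in auto)
  also have "\<dots> = kernel_dom \<alpha> a \<delta> x + kernel_dom \<alpha> b \<delta> x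
    + D / \<eta> * (kernel_dom \<alpha> (a - \<eta>) T x + kernel_dom \<alpha> (b + \<eta>) T x)"
    unfolding kernel_dom_def y_def[symmetric] split by (simp add: algebra_simps)
  finally show ?thesis .
qed

lemma powr_sum4_le:
  fixes p q r s :: real
  assumes "0 \<le> p" "0 \<le> q" "0 \<le> r" "0 \<le> s" "0 < \<alpha>"
  shows "(p + q + r + s) powr \<alpha> \<le> 4 powr \<alpha> * (p powr \<alpha> + q powr \<alpha> + r powr \<alpha> + s powr \<alpha>)"
proof -
  define M where "M = max (max p q) (max r s)"
  have "(p + q + r + s) powr \<alpha> \<le> (4 * M) powr \<alpha>"
    using assms by (intro powr_mono2) (auto simp: M_def)
  also have "\<dots> = 4 powr \<alpha> * M powr \<alpha>" by (simp add: powr_mult)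
  also have "M powr \<alpha> \<le> p powr \<alpha> + q powr \<alpha> + r powr \<alpha> + s powr \<alpha>"
    unfolding M_def max_def by (auto intro: add_increasing add_increasing2)
  finally show ?thesis by simp
qed

definition increment_dom :: "real \<Rightarrow> real \<Rightarrow> real \<Rightarrow> real \<Rightarrow> real \<Rightarrow> real \<Rightarrow> real \<Rightarrow> real \<Rightarrow> real" where
  "increment_dom \<alpha> a b \<eta> T D \<delta> x = kernel_dom \<alpha> a \<delta> x + kernel_dom \<alpha> b \<delta> x
    + D / \<eta> * (kernel_dom \<alpha> (a - \<eta>) T x + kernel_dom \<alpha> (b + \<eta>) T x)"

lemma increment_dom_measurable [measurable]: "increment_dom \<alpha> a b \<eta> T D \<delta> \<in> borel_measurable borel"
  unfolding increment_dom_def by measurable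

text \<open>Everything is compared with \<delta>^(\<alpha> a): the term with b is smaller since
  \<delta> <= 1, and \<open>D\<close> is at most a multiple of \<delta>^a. Strict positivity matters
  because the integral becomes the normalisation of a probability density.\<close>

lemma increment_dom_integral:
  assumes \<alpha>: "0 < \<alpha>" and ab: "\<eta> < a" "a \<le> b" "b + \<eta> < 1" and \<eta>: "0 < \<eta>" and T: "0 < T"
    and D: "0 \<le> D" "D \<le> C * \<delta> powr a" and \<delta>: "0 < \<delta>" "\<delta> \<le> 1"
  shows "integrable lborel (\<lambda>x. increment_dom \<alpha> a b \<eta> T D \<delta> x powr \<alpha>)"
    and "0 < (LBINT x. increment_dom \<alpha> a b \<eta> T D \<delta> x powr \<alpha>)"
    and "(LBINT x. increment_dom \<alpha> a b \<eta> T D \<delta> x powr \<alpha>) \<le>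
      4 powr \<alpha> * (kernel_mass \<alpha> a + kernel_mass \<alpha> b + (C / \<eta>) powr \<alpha> *
        (T powr (\<alpha> * (a - \<eta>)) * kernel_mass \<alpha> (a - \<eta>) + T powr (\<alpha> * (b + \<eta>)) * kernel_mass \<alpha> (b + \<eta>)))
      * \<delta> powr (\<alpha> * a)"
proof -
  let ?F = "increment_dom \<alpha> a b \<eta> T D \<delta>"
  define B where "B = (\<lambda>x. 4 powr \<alpha> * (kernel_dom \<alpha> a \<delta> x powr \<alpha> + kernel_dom \<alpha> b \<delta> x powr \<alpha>
    + (D / \<eta>) powr \<alpha> * kernel_dom \<alpha> (a - \<eta>) T x powr \<alpha> + (D / \<eta>) powr \<alpha> * kernel_dom \<alpha> (b + \<eta>) T x powr \<alpha>))"
  have FB: "?F x powr \<alpha> \<le> B x" for x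
  proof -
    have "?F x = kernel_dom \<alpha> a \<delta> x + kernel_dom \<alpha> b \<delta> x
      + D / \<eta> * kernel_dom \<alpha> (a - \<eta>) T x + D / \<eta> * kernel_dom \<alpha> (b + \<eta>) T x"
      by (simp add: increment_dom_def ring_distribs)
    moreover have "(D / \<eta> * k) powr \<alpha> = (D / \<eta>) powr \<alpha> * k powr \<alpha>" for k
      by (rule powr_mult)
    ultimately show ?thesis
    using powr_sum4_le[of "kernel_dom \<alpha> a \<delta> x" "kernel_dom \<alpha> b \<delta> x"
        "D / \<eta> * kernel_dom \<alpha> (a - \<eta>) T x" "D / \<eta> * kernel_dom \<alpha> (b + \<eta>) T x" \<alpha>]
      D \<eta> T \<delta> \<alpha>
    by (simp add: B_def kernel_dom_nonneg)
  qed
  have B0: "0 \<le> B x" for x unfolding B_def by (intro mult_nonneg_nonneg add_nonneg_nonneg) auto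
  have ia: "integrable lborel (\<lambda>x. kernel_dom \<alpha> a \<delta> x powr \<alpha>)"
    and ib: "integrable lborel (\<lambda>x. kernel_dom \<alpha> b \<delta> x powr \<alpha>)"
    and ic: "integrable lborel (\<lambda>x. kernel_dom \<alpha> (a - \<eta>) T x powr \<alpha>)"
    and id: "integrable lborel (\<lambda>x. kernel_dom \<alpha> (b + \<eta>) T x powr \<alpha>)"
    using ab \<eta> by (intro kernel_dom_scaled(1)[OF \<alpha>] \<delta> T; linarith)+
  have iB: "integrable lborel B"
    unfolding B_def by (intro integrable_mult_right Bochner_Integration.integrable_add ia ib ic id)
  show iF: "integrable lborel (\<lambda>x. ?F x powr \<alpha>)"
    by (rule Bochner_Integration.integrable_bound[OF iB]) (use FB B0 in auto)
  have "(LBINT x. ?F x powr \<alpha>) \<le> (LBINT x. B x)"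
    using iF iB FB by (intro integral_mono)
  also have "(LBINT x. B x) = 4 powr \<alpha> * (\<delta> powr (\<alpha> * a) * kernel_mass \<alpha> a + \<delta> powr (\<alpha> * b) * kernel_mass \<alpha> b
    + (D / \<eta>) powr \<alpha> * (T powr (\<alpha> * (a - \<eta>)) * kernel_mass \<alpha> (a - \<eta>))
    + (D / \<eta>) powr \<alpha> * (T powr (\<alpha> * (b + \<eta>)) * kernel_mass \<alpha> (b + \<eta>)))"
    unfolding B_def integral_mult_right_zero
    using ab \<eta> by (simp add: ia ib ic id kernel_dom_scaled(2)[OF \<alpha>] \<delta> T)
  also have "\<dots> \<le> 4 powr \<alpha> * (\<delta> powr (\<alpha> * a) * kernel_mass \<alpha> a + \<delta> powr (\<alpha> * a) * kernel_mass \<alpha> b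
    + ((C / \<eta>) powr \<alpha> * \<delta> powr (\<alpha> * a)) * (T powr (\<alpha> * (a - \<eta>)) * kernel_mass \<alpha> (a - \<eta>))
    + ((C / \<eta>) powr \<alpha> * \<delta> powr (\<alpha> * a)) * (T powr (\<alpha> * (b + \<eta>)) * kernel_mass \<alpha> (b + \<eta>)))"
  proof -
    have 1: "\<delta> powr (\<alpha> * b) \<le> \<delta> powr (\<alpha> * a)" using \<delta> \<alpha> ab by (intro powr_mono') auto
    have "0 \<le> C * \<delta> powr a" using D by linarith
    then have C: "0 \<le> C" using \<delta> by (simp add: zero_le_mult_iff)
    have "(D / \<eta>) powr \<alpha> \<le> (C / \<eta> * \<delta> powr a) powr \<alpha>"
      using D \<eta> \<alpha> by (intro powr_mono2) (auto simp: field_simps)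
    also have "\<dots> = (C / \<eta>) powr \<alpha> * \<delta> powr (\<alpha> * a)"
      by (simp only: powr_mult powr_powr mult.commute[of a \<alpha>])
    finally have 2: "(D / \<eta>) powr \<alpha> \<le> (C / \<eta>) powr \<alpha> * \<delta> powr (\<alpha> * a)" .
    show ?thesis
      by (intro mult_left_mono add_mono mult_right_mono 1 2 mult_nonneg_nonneg kernel_mass_nonneg) auto
  qed
  finally show "(LBINT x. ?F x powr \<alpha>) \<le>
      4 powr \<alpha> * (kernel_mass \<alpha> a + kernel_mass \<alpha> b + (C / \<eta>) powr \<alpha> *
        (T powr (\<alpha> * (a - \<eta>)) * kernel_mass \<alpha> (a - \<eta>) + T powr (\<alpha> * (b + \<eta>)) * kernel_mass \<alpha> (b + \<eta>)))
      * \<delta> powr (\<alpha> * a)"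
    by (simp add: algebra_simps)
  have "(LBINT x. ?F x powr \<alpha>) \<noteq> 0"
  proof
    assume "(LBINT x. ?F x powr \<alpha>) = 0"
    then have "AE x in lborel. ?F x powr \<alpha> = 0"
      by (subst (asm) integral_nonneg_eq_0_iff_AE[OF iF]) auto
    then have "AE x in lborel. x \<notin> {1<..<2::real}"
    proof (rule AE_mp, intro AE_I2 impI notI)
      fix x :: real assume 0: "?F x powr \<alpha> = 0" and x: "x \<in> {1<..<2}"
      have "0 < kernel_dom \<alpha> a \<delta> x" using x \<delta> by (simp add: kernel_dom_def)
      then have "0 < ?F x" using D \<eta> T \<delta> unfolding increment_dom_def
        by (intro add_pos_nonneg mult_nonneg_nonneg add_nonneg_nonneg kernel_dom_nonneg) auto
      then show False using 0 by simp
    qed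
    then have "emeasure lborel {1<..<2::real} = 0"
      by (subst (asm) AE_iff_measurable[of "{1<..<2}"]) auto
    then show False by simp
  qed
  moreover have "0 \<le> (LBINT x. ?F x powr \<alpha>)" by (intro integral_nonneg_AE) auto
  ultimately show "0 < (LBINT x. ?F x powr \<alpha>)" by linarith
qed

section \<open>Increments along the dyadic grid\<close>

lemma sum_lessThan_add:
  fixes f :: "nat \<Rightarrow> 'b::comm_monoid_add"
  shows "(\<Sum>i<m + n. f i) = (\<Sum>i<m. f i) + (\<Sum>i<n. f (m + i))"
  by (induction n) (auto simp: add.assoc)

locale rhmsp = prob_space P for P :: "'a measure" +
  fixes \<alpha> :: real and H :: "real \<Rightarrow> real" and X :: "real \<Rightarrow> 'a \<Rightarrow> real" and C \<gamma> :: real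
  assumes \<alpha>: "1 < \<alpha>" "\<alpha> < 2"
    and H_bdd: "bdd_below (H ` {0..})" "bdd_above (H ` {0..})"
    and H_inf_pos: "0 < (INF t\<in>{0..}. H t)" and H_sup_less_1: "(SUP t\<in>{0..}. H t) < 1"
    and C_pos: "0 < C" and \<gamma>: "(SUP t\<in>{0..}. H t) < \<gamma>"
    and H_holder: "\<forall>t\<ge>0. \<forall>s\<ge>0. \<bar>H t - H s\<bar> \<le> C * \<bar>t - s\<bar> powr \<gamma>"
    and X: "is_rhmsp P \<alpha> H X"
begin

definition Hmin :: real where "Hmin = (INF t\<in>{0..}. H t)"
definition Hmax :: real where "Hmax = (SUP t\<in>{0..}. H t)"

lemma H_bounds: "0 \<le> t \<Longrightarrow> Hmin \<le> H t" "0 \<le> t \<Longrightarrow> H t \<le> Hmax"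
  unfolding Hmin_def Hmax_def using H_bdd by (auto intro: cINF_lower cSUP_upper)

lemma Hmin_pos: "0 < Hmin" and Hmax_less_1: "Hmax < 1" and Hmin_le_Hmax: "Hmin \<le> Hmax"
  and Hmax_less_\<gamma>: "Hmax < \<gamma>"
  using H_inf_pos H_sup_less_1 \<gamma> H_bounds[of 0] by (auto simp: Hmin_def Hmax_def)

lemma X_measurable: "0 \<le> t \<Longrightarrow> X t \<in> borel_measurable P"
  using X by (simp add: is_rhmsp_def)

text \<open>An increment is a combination of two values, so the times t and s are concatenated, with
  coefficients u and -u.\<close>

lemma increments_char:
  fixes t s u :: "nat \<Rightarrow> real"
  assumes t: "\<And>j. j < m \<Longrightarrow> 0 \<le> t j" and s: "\<And>j. j < m \<Longrightarrow> 0 \<le> s j"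
  shows "(LINT \<omega>|P. cis (\<Sum>j<m. u j * (X (t j) \<omega> - X (s j) \<omega>))) =
    complex_of_real (exp (- (LBINT x. cmod (\<Sum>j<m. complex_of_real (u j) *
      (rhmsp_kernel \<alpha> H (t j) x - rhmsp_kernel \<alpha> H (s j) x)) powr \<alpha>)))"
proof -
  define ts where "ts = (\<lambda>i. if i < m then t i else s (i - m))"
  define us where "us = (\<lambda>i. if i < m then u i else - u (i - m))"
  have "\<forall>j<m + m. 0 \<le> ts j" using t s by (auto simp: ts_def)
  then have "(LINT \<omega>|P. cis (\<Sum>j<m + m. us j * X (ts j) \<omega>)) =
    complex_of_real (exp (- (LBINT x. cmod (\<Sum>j<m + m. complex_of_real (us j) * rhmsp_kernel \<alpha> H (ts j) x) powr \<alpha>)))"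
    using X unfolding is_rhmsp_def by blast
  moreover have "(\<Sum>j<m + m. us j * X (ts j) \<omega>) = (\<Sum>j<m. u j * (X (t j) \<omega> - X (s j) \<omega>))" for \<omega>
    by (simp add: sum_lessThan_add us_def ts_def algebra_simps sum_subtractf sum_negf)
  moreover have "(\<Sum>j<m + m. complex_of_real (us j) * rhmsp_kernel \<alpha> H (ts j) x) =
      (\<Sum>j<m. complex_of_real (u j) * (rhmsp_kernel \<alpha> H (t j) x - rhmsp_kernel \<alpha> H (s j) x))" for x
    by (simp add: sum_lessThan_add us_def ts_def algebra_simps sum_subtractf sum_negf)
  ultimately show ?thesis by simp
qed

text \<open>For a given process the constant depends on the horizon alone, not on the lag, the
  number of increments or the thresholds, so it serves all dyadic levels.\<close>

lemma increments_max_tail: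
  assumes T: "0 < T"
  obtains c where "\<And>\<delta> m t s l y. \<lbrakk>0 < \<delta>; \<delta> \<le> 1; 0 < l; 0 < y;
      \<And>j. j < m \<Longrightarrow> 0 \<le> t j \<and> t j \<le> T \<and> 0 \<le> s j \<and> \<bar>t j - s j\<bar> \<le> \<delta>\<rbrakk>
    \<Longrightarrow> prob {\<omega> \<in> space P. \<exists>j<m. 2 * l \<le> \<bar>X (t j) \<omega> - X (s j) \<omega>\<bar>}
      \<le> 2 * real m * exp (- l\<^sup>2 / (2 * y\<^sup>2)) + c * \<delta> powr (\<alpha> * Hmin) * y powr (- \<alpha>)"
proof -
  \<comment> \<open>Half the margin keeps the widened exponents \<open>Hmin - \<eta>\<close> and
    \<open>Hmax + \<eta>\<close> inside (0,1).\<close>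
  define \<eta> where "\<eta> = min Hmin (1 - Hmax) / 2"
  have \<eta>: "0 < \<eta>" "\<eta> < Hmin" "Hmax + \<eta> < 1"
    using Hmin_pos Hmax_less_1 by (auto simp: \<eta>_def min_def field_simps)
  have \<alpha>0: "0 < \<alpha>" using \<alpha> by simp
  define c0 where "c0 = 4 powr \<alpha> * (kernel_mass \<alpha> Hmin + kernel_mass \<alpha> Hmax + (C / \<eta>) powr \<alpha> *
        (T powr (\<alpha> * (Hmin - \<eta>)) * kernel_mass \<alpha> (Hmin - \<eta>) + T powr (\<alpha> * (Hmax + \<eta>)) * kernel_mass \<alpha> (Hmax + \<eta>)))"
  show thesis
  proof (rule that[of "c0 / (1 - exp (- 1 / 2))"])
    fix \<delta> l y :: real and m :: nat and t s :: "nat \<Rightarrow> real"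
    assume \<delta>: "0 < \<delta>" "\<delta> \<le> 1" and l: "0 < l" and y: "0 < y"
      and ts: "\<And>j. j < m \<Longrightarrow> 0 \<le> t j \<and> t j \<le> T \<and> 0 \<le> s j \<and> \<bar>t j - s j\<bar> \<le> \<delta>"
    define D where "D = C * \<delta> powr \<gamma>"
    \<comment> \<open>Since \<delta> <= 1 and \<gamma> > \<open>Hmax\<close> >= \<open>Hmin\<close>,
      the variation of H over the lag is of order \<delta>^Hmin at most.\<close>
    have D: "0 \<le> D" "D \<le> C * \<delta> powr Hmin"
      using C_pos \<delta> Hmin_le_Hmax Hmax_less_\<gamma> by (auto simp: D_def intro!: powr_mono')
    define F where "F = increment_dom \<alpha> Hmin Hmax \<eta> T D \<delta>"
    note F = increment_dom_integral[OF \<alpha>0 \<eta>(2) Hmin_le_Hmax \<eta>(3) \<eta>(1) T D \<delta>, folded F_def c0_def]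
    define S where "S = (LBINT x. F x powr \<alpha>)"
    have "prob {\<omega> \<in> space P. \<exists>j<m. 2 * l \<le> \<bar>X (t j) \<omega> - X (s j) \<omega>\<bar>}
      \<le> 2 * real m * exp (- l\<^sup>2 / (2 * y\<^sup>2)) + S * y powr (- \<alpha>) / (1 - exp (- 1 / 2))"
    proof (rule stable_max_tail[where F=F and Z="\<lambda>j \<omega>. X (t j) \<omega> - X (s j) \<omega>" and g="\<lambda>j x. rhmsp_kernel \<alpha> H (t j) x - rhmsp_kernel \<alpha> H (s j) x",
          OF prob_space_axioms \<alpha>0 \<alpha>(2)])
      show "(\<lambda>\<omega>. X (t j) \<omega> - X (s j) \<omega>) \<in> borel_measurable P" if "j < m" for j
        using ts[OF that] by (intro borel_measurable_diff X_measurable) auto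
      show "(\<lambda>x. rhmsp_kernel \<alpha> H (t j) x - rhmsp_kernel \<alpha> H (s j) x) \<in> borel_measurable borel" for j
        unfolding rhmsp_kernel_def by measurable
      show "cmod (rhmsp_kernel \<alpha> H (t j) x - rhmsp_kernel \<alpha> H (s j) x) \<le> F x" if "j < m" for j x
      proof -
        have "\<bar>H (t j) - H (s j)\<bar> \<le> C * \<bar>t j - s j\<bar> powr \<gamma>" using H_holder ts[OF that] by auto
        also have "\<dots> \<le> D" unfolding D_def
          using C_pos ts[OF that] H_inf_pos Hmax_less_\<gamma> Hmin_le_Hmax Hmin_pos
          by (intro mult_left_mono powr_mono2) auto
        finally show ?thesis
          unfolding F_def increment_dom_def using ts[OF that] \<eta> H_bounds
          by (intro rhmsp_kernel_diff_le) auto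
      qed
      show "(LINT \<omega>|P. cis (\<Sum>j<m. u j * (X (t j) \<omega> - X (s j) \<omega>))) =
        complex_of_real (exp (- (LBINT x. cmod (\<Sum>j<m. complex_of_real (u j) *
          (rhmsp_kernel \<alpha> H (t j) x - rhmsp_kernel \<alpha> H (s j) x)) powr \<alpha>)))" for u
        using ts by (intro increments_char) auto
      show "F \<in> borel_measurable borel" unfolding F_def by measurable
    qed (use F l y S_def in auto)
    also have "S * y powr (- \<alpha>) / (1 - exp (- 1 / 2)) \<le> (c0 * \<delta> powr (\<alpha> * Hmin)) * y powr (- \<alpha>) / (1 - exp (- 1 / 2))"
      using F(3) unfolding S_def by (intro divide_right_mono mult_right_mono) auto
    finally show "prob {\<omega> \<in> space P. \<exists>j<m. 2 * l \<le> \<bar>X (t j) \<omega> - X (s j) \<omega>\<bar>}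
      \<le> 2 * real m * exp (- l\<^sup>2 / (2 * y\<^sup>2)) + c0 / (1 - exp (- 1 / 2)) * \<delta> powr (\<alpha> * Hmin) * y powr (- \<alpha>)"
      by (simp add: mult_ac)
  qed
qed

text \<open>Any family of at most L 2^n pairs at level n is allowed, because two families occur:
  neighbouring grid points, and a point with its dyadic approximation.\<close>

lemma dyadic_increments_eventually:
  fixes L :: nat and m :: "nat \<Rightarrow> nat" and t s :: "nat \<Rightarrow> nat \<Rightarrow> real"
  assumes L: "0 < L" and \<epsilon>: "0 < \<epsilon>" and m: "\<And>n. m n \<le> L * 2 ^ n"
    and ts: "\<And>n j. j < m n \<Longrightarrow> 0 \<le> t n j \<and> t n j \<le> L \<and> 0 \<le> s n j \<and> \<bar>t n j - s n j\<bar> \<le> (1/2) ^ n"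
  shows "AE \<omega> in P. \<forall>\<^sub>F n in sequentially. \<forall>j<m n. \<bar>X (t n j) \<omega> - X (s n j) \<omega>\<bar>
    \<le> 4 * (((1/2) ^ n) powr Hmin * real n powr (1/\<alpha> + 1/2 + \<epsilon>))"
proof -
  obtain c where c: "\<And>\<delta> m t s l y. \<lbrakk>0 < \<delta>; \<delta> \<le> 1; 0 < l; 0 < y;
      \<And>j. j < m \<Longrightarrow> 0 \<le> t j \<and> t j \<le> real L \<and> 0 \<le> s j \<and> \<bar>t j - s j\<bar> \<le> \<delta>\<rbrakk>
    \<Longrightarrow> prob {\<omega> \<in> space P. \<exists>j<m. 2 * l \<le> \<bar>X (t j) \<omega> - X (s j) \<omega>\<bar>}
      \<le> 2 * real m * exp (- l\<^sup>2 / (2 * y\<^sup>2)) + c * \<delta> powr (\<alpha> * Hmin) * y powr (- \<alpha>)"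
    using increments_max_tail[of "real L"] L by auto
  define A where "A = (\<lambda>n. {\<omega> \<in> space P. \<exists>j<m n.
    4 * (((1/2) ^ n) powr Hmin * real n powr (1/\<alpha> + 1/2 + \<epsilon>)) \<le> \<bar>X (t n j) \<omega> - X (s n j) \<omega>\<bar>})"
  have A_sets: "A n \<in> events" for n
  proof -
    have "A n = (\<Union>j<m n. {\<omega> \<in> space P.
      4 * (((1/2) ^ n) powr Hmin * real n powr (1/\<alpha> + 1/2 + \<epsilon>)) \<le> \<bar>X (t n j) \<omega> - X (s n j) \<omega>\<bar>})"
      unfolding A_def by auto
    also have "\<dots> \<in> events"
    proof (intro sets.finite_UN)
      fix j assume "j \<in> {..<m n}"
      then have [measurable]: "X (t n j) \<in> borel_measurable P" "X (s n j) \<in> borel_measurable P"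
        using ts by (auto intro: X_measurable)
      show "{\<omega> \<in> space P. 4 * (((1/2) ^ n) powr Hmin * real n powr (1/\<alpha> + 1/2 + \<epsilon>)) \<le> \<bar>X (t n j) \<omega> - X (s n j) \<omega>\<bar>} \<in> events"
        by measurable
    qed simp
    finally show ?thesis .
  qed
  have bound: "prob (A n) \<le> 2 * L * (2 * exp (- 2)) ^ n + c * real n powr (- (1 + \<alpha> * \<epsilon>))" if n: "1 \<le> n" for n
  proof -
    define \<delta> :: real where "\<delta> = (1/2) ^ n"
    \<comment> \<open>This choice turns the polynomial term into c n^(-1 - \<alpha> \<epsilon>),
      which is summable.\<close>
    define y where "y = \<delta> powr Hmin * real n powr (1/\<alpha> + \<epsilon>)"
    \<comment> \<open>Now l^2 / (2 y^2) = 2 n, and 2^n exp (-2 n) is summable because exp 2 > 2. The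
      root of n is the extra 1/2 in the exponent.\<close>
    define l where "l = 2 * sqrt n * y"
    have \<delta>: "0 < \<delta>" "\<delta> \<le> 1" by (auto simp: \<delta>_def power_le_one)
    have y: "0 < y" using \<delta> n by (simp add: y_def)
    have l: "0 < l" using y n by (simp add: l_def)
    have 2: "2 * l = 4 * (\<delta> powr Hmin * real n powr (1/\<alpha> + 1/2 + \<epsilon>))"
    proof -
      have "1/\<alpha> + 1/2 + \<epsilon> = 1/2 + (1/\<alpha> + \<epsilon>)" by simp
      then have "real n powr (1/\<alpha> + 1/2 + \<epsilon>) = sqrt n * real n powr (1/\<alpha> + \<epsilon>)"
        by (simp only: powr_add powr_half_sqrt of_nat_0_le_iff)
      then show ?thesis by (simp add: l_def y_def)
    qed
    have 3: "l\<^sup>2 / (2 * y\<^sup>2) = real (2 * n)"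
      using y by (simp add: l_def power_mult_distrib)
    have 4: "\<delta> powr (\<alpha> * Hmin) * y powr (- \<alpha>) = real n powr (- (1 + \<alpha> * \<epsilon>))"
    proof -
      have "y powr (- \<alpha>) = \<delta> powr (Hmin * (- \<alpha>)) * real n powr ((1/\<alpha> + \<epsilon>) * (- \<alpha>))"
        unfolding y_def powr_mult powr_powr ..
      moreover have "(1/\<alpha> + \<epsilon>) * (- \<alpha>) = - (1 + \<alpha> * \<epsilon>)" using \<alpha> by (simp add: algebra_simps)
      moreover have "\<delta> powr (\<alpha> * Hmin) * \<delta> powr (Hmin * (- \<alpha>)) = 1"
        using \<delta> by (simp add: mult.commute flip: powr_add)
      ultimately show ?thesis by (simp only: mult.assoc[symmetric] mult_1_left)
    qed
    have "prob (A n) \<le> 2 * real (m n) * exp (- l\<^sup>2 / (2 * y\<^sup>2)) + c * \<delta> powr (\<alpha> * Hmin) * y powr (- \<alpha>)"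
      unfolding A_def 2[unfolded \<delta>_def, symmetric]
      using ts by (intro c \<delta> l y) (auto simp: \<delta>_def)
    also have "\<dots> = 2 * real (m n) * exp (- 2 * real n) + c * real n powr (- (1 + \<alpha> * \<epsilon>))"
      using 3 4 by (simp add: mult.assoc)
    also have "2 * real (m n) * exp (- 2 * real n) \<le> 2 * real (L * 2 ^ n) * exp (- 2 * real n)"
      using m[of n] by (intro mult_left_mono mult_right_mono of_nat_mono) auto
    also have "\<dots> = 2 * L * (2 * exp (- 2)) ^ n"
      by (simp add: power_mult_distrib exp_of_nat_mult[symmetric] mult.commute)
    finally show ?thesis by simp
  qed
  have "summable (\<lambda>n. prob (A n))"
  proof (rule summable_comparison_test')
    have "2 * exp (- 2 :: real) < 1"
      using exp_ge_add_one_self[of "2::real"] by (simp add: exp_minus field_simps)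
    then have "summable (\<lambda>n. (2 * exp (- 2 :: real)) ^ n)" by (intro summable_geometric) auto
    moreover have "summable (\<lambda>n. real n powr (- (1 + \<alpha> * \<epsilon>)))"
      using \<alpha> \<epsilon> by (subst summable_real_powr_iff) auto
    ultimately show "summable (\<lambda>n. 2 * L * (2 * exp (- 2)) ^ n + c * real n powr (- (1 + \<alpha> * \<epsilon>)))"
      by (intro summable_add summable_mult)
    show "norm (prob (A n)) \<le> 2 * L * (2 * exp (- 2)) ^ n + c * real n powr (- (1 + \<alpha> * \<epsilon>))" if "n \<ge> 1" for n
      using bound[OF that] by simp
  qed
  then have "AE \<omega> in P. \<forall>\<^sub>F n in sequentially. \<omega> \<in> space P - A n"
    by (intro borel_cantelli_AE1 A_sets) (auto simp: emeasure_eq_measure)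
  then show ?thesis
  proof (rule AE_mp, intro AE_I2 impI)
    fix \<omega> assume "\<omega> \<in> space P" "\<forall>\<^sub>F n in sequentially. \<omega> \<in> space P - A n"
    then show "\<forall>\<^sub>F n in sequentially. \<forall>j<m n. \<bar>X (t n j) \<omega> - X (s n j) \<omega>\<bar>
      \<le> 4 * (((1/2) ^ n) powr Hmin * real n powr (1/\<alpha> + 1/2 + \<epsilon>))"
      by (elim eventually_mono) (auto simp: A_def not_le intro: less_imp_le)
  qed
qed

end

section \<open>Chaining for a single path\<close>

definition dyadic_floor :: "nat \<Rightarrow> real \<Rightarrow> real" where
  "dyadic_floor n t = real_of_int \<lfloor>2 ^ n * t\<rfloor> / 2 ^ n"

lemma dyadic_floor_bounds:
  assumes "0 \<le> t"
  shows "0 \<le> dyadic_floor n t" "dyadic_floor n t \<le> t" "\<bar>t - dyadic_floor n t\<bar> \<le> (1/2) ^ n"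
proof -
  have "0 \<le> \<lfloor>2 ^ n * t\<rfloor>" using assms by simp
  then show "0 \<le> dyadic_floor n t" by (simp add: dyadic_floor_def)
  have 1: "real_of_int \<lfloor>2 ^ n * t\<rfloor> \<le> 2 ^ n * t" "2 ^ n * t \<le> real_of_int \<lfloor>2 ^ n * t\<rfloor> + 1"
    by linarith+
  then show 2: "dyadic_floor n t \<le> t" by (simp add: dyadic_floor_def field_simps)
  show "\<bar>t - dyadic_floor n t\<bar> \<le> (1/2) ^ n"
  proof -
    have "t \<le> (real_of_int \<lfloor>2 ^ n * t\<rfloor> + 1) / 2 ^ n"
      using 1 by (simp add: pos_le_divide_eq mult.commute)
    also have "\<dots> = dyadic_floor n t + (1/2) ^ n"
      by (simp add: dyadic_floor_def add_divide_distrib power_one_over)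
    finally show ?thesis using 2 by simp
  qed
qed

text \<open>Up to constants, the function \<delta>^a |ln \<delta>|^\<rho> at \<delta> =
  2^(-n).\<close>

definition modulus_scale :: "real \<Rightarrow> real \<Rightarrow> nat \<Rightarrow> real" where
  "modulus_scale a \<rho> n = ((1/2) ^ n) powr a * real n powr \<rho>"

lemma modulus_scale_nonneg: "0 \<le> modulus_scale a \<rho> n"
  by (simp add: modulus_scale_def)

text \<open>The inequality n + k <= n (k + 1), valid for n >= 1, separates the polynomial factor, so
  that sums over finer levels are controlled by the value at level n.\<close>

lemma modulus_scale_shift_le:
  assumes "1 \<le> n" "0 \<le> \<rho>"
  shows "modulus_scale a \<rho> (n + k) \<le> modulus_scale a \<rho> n * (((1/2) powr a) ^ k * real (Suc k) powr \<rho>)"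
proof -
  have "n + k \<le> n * Suc k" using assms by (cases n) auto
  then have "real (n + k) powr \<rho> \<le> (real n * real (Suc k)) powr \<rho>"
    unfolding of_nat_mult[symmetric] using assms by (intro powr_mono2 of_nat_mono) auto
  also have "\<dots> = real n powr \<rho> * real (Suc k) powr \<rho>" by (rule powr_mult)
  finally have "((1/2) ^ (n + k)) powr a * real (n + k) powr \<rho>
     \<le> ((1/2) ^ (n + k)) powr a * (real n powr \<rho> * real (Suc k) powr \<rho>)"
    by (intro mult_left_mono) auto
  moreover have "((1/2::real) ^ (n + k)) powr a = ((1/2) ^ n) powr a * ((1/2) powr a) ^ k"
    by (simp add: power_add powr_mult powr_power powr_powr mult.commute flip: powr_realpow)
  ultimately show ?thesis by (simp only: modulus_scale_def mult_ac)
qed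

lemma summable_geometric_powr:
  fixes q \<rho> :: real
  assumes q: "0 \<le> q" "q < 1"
  shows "summable (\<lambda>k. q ^ k * real (Suc k) powr \<rho>)"
proof -
  have "(\<lambda>k. real (Suc (Suc k)) / real (Suc k)) \<longlonglongrightarrow> 1"
    by real_asymp
  then have "(\<lambda>k. q * (real (Suc (Suc k)) / real (Suc k)) powr \<rho>) \<longlonglongrightarrow> q * 1 powr \<rho>"
    by (intro tendsto_mult tendsto_powr tendsto_const) auto
  then have "\<forall>\<^sub>F k in sequentially. q * (real (Suc (Suc k)) / real (Suc k)) powr \<rho> < (1 + q) / 2"
    using q by (intro order_tendstoD(2)[where y="q * 1 powr \<rho>"]) auto
  then obtain N where N: "\<And>k. N \<le> k \<Longrightarrow> q * (real (Suc (Suc k)) / real (Suc k)) powr \<rho> < (1 + q) / 2"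
    by (auto simp: eventually_at_top_linorder)
  show ?thesis
  proof (rule summable_ratio_test[of "(1 + q) / 2" N])
    show "(1 + q) / 2 < 1" using q by simp
    fix k assume "N \<le> k"
    have "q ^ Suc k * real (Suc (Suc k)) powr \<rho>
      = (q * (real (Suc (Suc k)) / real (Suc k)) powr \<rho>) * (q ^ k * real (Suc k) powr \<rho>)"
      by (simp add: powr_divide)
    also have "\<dots> \<le> (1 + q) / 2 * (q ^ k * real (Suc k) powr \<rho>)"
      using N[OF \<open>N \<le> k\<close>] q by (intro mult_right_mono) auto
    finally show "norm (q ^ Suc k * real (Suc (Suc k)) powr \<rho>) \<le> (1 + q) / 2 * norm (q ^ k * real (Suc k) powr \<rho>)"
      using q by simp
  qed
qed

definition modulus_sum :: "real \<Rightarrow> real \<Rightarrow> real" where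
  "modulus_sum a \<rho> = (\<Sum>k. ((1/2) powr a) ^ k * real (Suc k) powr \<rho>)"

lemma modulus_scale_sums:
  assumes n: "1 \<le> n" and \<rho>: "0 \<le> \<rho>" and a: "0 < a"
  shows "summable (\<lambda>k. modulus_scale a \<rho> (n + k))" "(\<Sum>k. modulus_scale a \<rho> (n + k)) \<le> modulus_scale a \<rho> n * modulus_sum a \<rho>"
proof -
  have "(1/2::real) powr a < 1" using a powr_less_mono2[of a "1/2" "1::real"] by simp
  then have s: "summable (\<lambda>k. ((1/2) powr a) ^ k * real (Suc k) powr \<rho>)"
    by (intro summable_geometric_powr) auto
  then show 1: "summable (\<lambda>k. modulus_scale a \<rho> (n + k))"
    by (intro summable_comparison_test'[OF summable_mult[OF s, of "modulus_scale a \<rho> n"], of 0])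
      (use modulus_scale_shift_le[OF n \<rho>] modulus_scale_nonneg in auto)
  show "(\<Sum>k. modulus_scale a \<rho> (n + k)) \<le> modulus_scale a \<rho> n * modulus_sum a \<rho>"
    unfolding modulus_sum_def suminf_mult[OF s, symmetric]
    using 1 s by (intro suminf_le summable_mult modulus_scale_shift_le[OF n \<rho>])
qed

lemma modulus_sum_nonneg: "0 < a \<Longrightarrow> 0 \<le> modulus_sum a \<rho>"
  unfolding modulus_sum_def
  using powr_less_mono2[of a "1/2" "1::real"]
  by (intro suminf_nonneg summable_geometric_powr) auto

text \<open>The deterministic outcome of Borel-Cantelli for one sample path. Only values at dyadic
  points enter, and \<open>n0\<close> may depend on the path.\<close>

locale dyadic_path =
  fixes x :: "real \<Rightarrow> real" and K a \<rho> :: real and L n0 :: nat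
  assumes K: "0 \<le> K" and a: "0 < a" and \<rho>: "0 \<le> \<rho>" and n0: "1 \<le> n0"
    and increments: "\<And>n j. n0 \<le> n \<Longrightarrow> j < L * 2 ^ n \<Longrightarrow>
      \<bar>x (real (Suc j) / 2 ^ n) - x (real j / 2 ^ n)\<bar> \<le> K * modulus_scale a \<rho> n"
begin

text \<open>This depends on \<open>x\<close> alone and not on the constants of the locale, so the
  same function appears for every horizon and every logarithmic exponent.\<close>

definition y :: "real \<Rightarrow> real" where
  "y t = lim (\<lambda>n. x (dyadic_floor n t))"

text \<open>On passing to the next level the dyadic floor either stays or moves by exactly one step
  of the finer grid.\<close>

lemma refine:
  fixes t :: real
  assumes t: "0 \<le> t" "t \<le> L" and n: "n0 \<le> n"
  shows "\<bar>x (dyadic_floor (Suc n) t) - x (dyadic_floor n t)\<bar> \<le> K * modulus_scale a \<rho> (Suc n)"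
proof -
  define i where "i = nat \<lfloor>2 ^ n * t\<rfloor>"
  have i: "real_of_int \<lfloor>2 ^ n * t\<rfloor> = real i" using t by (simp add: i_def)
  have "real i \<le> 2 ^ n * t" "2 ^ n * t < real i + 1" using i by linarith+
  then have "real (2 * i) \<le> 2 ^ Suc n * t" "2 ^ Suc n * t < real (2 * i) + 2" by auto
  then have "\<lfloor>2 ^ Suc n * t\<rfloor> = int (2 * i) \<or> \<lfloor>2 ^ Suc n * t\<rfloor> = int (Suc (2 * i))"
    by linarith
  then consider "\<lfloor>2 ^ Suc n * t\<rfloor> = int (2 * i)" | "\<lfloor>2 ^ Suc n * t\<rfloor> = int (Suc (2 * i))" by blast
  moreover have e: "dyadic_floor n t = real (2 * i) / 2 ^ Suc n"
    by (simp add: dyadic_floor_def i)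
  ultimately show ?thesis
  proof cases
    case 1
    then have "dyadic_floor (Suc n) t = real (2 * i) / 2 ^ Suc n" unfolding dyadic_floor_def by simp
    then have "dyadic_floor (Suc n) t = dyadic_floor n t" unfolding e .
    then show ?thesis using K modulus_scale_nonneg by simp
  next
    case 2
    then have f: "dyadic_floor (Suc n) t = real (Suc (2 * i)) / 2 ^ Suc n"
      unfolding dyadic_floor_def by simp
    have "real (Suc (2 * i)) \<le> 2 ^ Suc n * t" using 2 by linarith
    also have "\<dots> \<le> 2 ^ Suc n * real L" using t by (intro mult_left_mono) auto
    finally have "real (Suc (2 * i)) \<le> real (L * 2 ^ Suc n)" by (simp add: mult.commute)
    then have "2 * i < L * 2 ^ Suc n" by (simp only: of_nat_le_iff) 
    then show ?thesis unfolding e f using n by (intro increments) auto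
  qed
qed

text \<open>The refinements telescope to an absolutely convergent series dominated by the scale
  function, whose tail sum is comparable to its value at level n.\<close>

lemma approx:
  fixes t :: real
  assumes t: "0 \<le> t" "t \<le> L" and n: "n0 \<le> n"
  shows "\<bar>y t - x (dyadic_floor n t)\<bar> \<le> K * modulus_scale a \<rho> n * modulus_sum a \<rho>"
proof -
  have n1: "1 \<le> n" using n n0 by simp
  define d where "d = (\<lambda>k. x (dyadic_floor (n + Suc k) t) - x (dyadic_floor (n + k) t))"
  have d: "\<bar>d k\<bar> \<le> K * modulus_scale a \<rho> (n + Suc k)" for k
    unfolding d_def using refine[OF t, of "n + k"] n by simp
  have s0: "summable (\<lambda>k. modulus_scale a \<rho> (n + k))" by (rule modulus_scale_sums(1)[OF n1 \<rho> a])
  then have s1: "summable (\<lambda>k. modulus_scale a \<rho> (n + Suc k))" by (subst summable_Suc_iff)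
  have s: "summable (\<lambda>k. K * modulus_scale a \<rho> (n + Suc k))" using s1 by (rule summable_mult)
  have sd: "summable (\<lambda>k. \<bar>d k\<bar>)"
    by (rule summable_comparison_test'[OF s, of 0]) (use d in auto)
  have "(\<lambda>N. \<Sum>k<N. d k) \<longlonglongrightarrow> suminf d"
    using summable_rabs_cancel[OF sd] by (rule summable_LIMSEQ)
  moreover have "(\<Sum>k<N. d k) = x (dyadic_floor (n + N) t) - x (dyadic_floor n t)" for N
    unfolding d_def by (induction N) auto
  ultimately have "(\<lambda>N. x (dyadic_floor (n + N) t) - x (dyadic_floor n t)) \<longlonglongrightarrow> suminf d" by simp
  then have "(\<lambda>N. x (dyadic_floor (N + n) t)) \<longlonglongrightarrow> suminf d + x (dyadic_floor n t)"
    by (subst (asm) add.commute) (auto dest: tendsto_add[OF _ tendsto_const[of "x (dyadic_floor n t)"]])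
  then have "(\<lambda>N. x (dyadic_floor N t)) \<longlonglongrightarrow> suminf d + x (dyadic_floor n t)"
    by (rule LIMSEQ_offset)
  then have "y t = suminf d + x (dyadic_floor n t)" unfolding y_def by (rule limI)
  then have "\<bar>y t - x (dyadic_floor n t)\<bar> = \<bar>suminf d\<bar>" by simp
  also have "\<dots> \<le> (\<Sum>k. \<bar>d k\<bar>)" by (rule summable_rabs[OF sd])
  also have "\<dots> \<le> (\<Sum>k. K * modulus_scale a \<rho> (n + Suc k))" by (intro suminf_le d sd s)
  also have "\<dots> = K * (\<Sum>k. modulus_scale a \<rho> (n + Suc k))" using s1 by (rule suminf_mult)
  also have "\<dots> \<le> K * (\<Sum>k. modulus_scale a \<rho> (n + k))"
    using suminf_split_head[OF s0] modulus_scale_nonneg[of a \<rho> n] K by (intro mult_left_mono) auto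
  also have "\<dots> \<le> K * (modulus_scale a \<rho> n * modulus_sum a \<rho>)"
    using K by (intro mult_left_mono modulus_scale_sums(2)[OF n1 \<rho> a])
  finally show ?thesis by (simp add: mult.assoc)
qed

text \<open>Two approximation errors from \<open>approx\<close> and one step of the grid.\<close>

definition K' :: real where "K' = K * (2 * modulus_sum a \<rho> + 1)"

lemma K'_nonneg: "0 \<le> K'"
  using K modulus_sum_nonneg[OF a] by (simp add: K'_def)

text \<open>Both points are replaced by their floors at level n, which are equal or adjacent when
  the distance is at most 2^(-n).\<close>

lemma increment_le:
  fixes t s :: real
  assumes t: "0 \<le> t" "t \<le> L" and s: "0 \<le> s" "s \<le> L" and n: "n0 \<le> n" and ts: "\<bar>t - s\<bar> \<le> (1/2) ^ n"
  shows "\<bar>y t - y s\<bar> \<le> K' * modulus_scale a \<rho> n"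
proof -
  have adj: "\<bar>x (dyadic_floor n t) - x (dyadic_floor n s)\<bar> \<le> K * modulus_scale a \<rho> n"
    if t: "0 \<le> t" "t \<le> L" and s: "0 \<le> s" and st: "s \<le> t" "\<bar>t - s\<bar> \<le> (1/2) ^ n" for s t :: real
  proof -
    define i where "i = nat \<lfloor>2 ^ n * s\<rfloor>"
    have i: "real_of_int \<lfloor>2 ^ n * s\<rfloor> = real i" using s by (simp add: i_def)
    have "2 ^ n * s \<le> 2 ^ n * t" using st by simp
    moreover have "2 ^ n * t \<le> 2 ^ n * s + 1" using st by (simp add: field_simps)
    ultimately have "\<lfloor>2 ^ n * t\<rfloor> = int i \<or> \<lfloor>2 ^ n * t\<rfloor> = int (Suc i)" using i by linarith
    then show ?thesis
    proof
      assume "\<lfloor>2 ^ n * t\<rfloor> = int i"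
      then show ?thesis using K modulus_scale_nonneg i by (simp add: dyadic_floor_def)
    next
      assume *: "\<lfloor>2 ^ n * t\<rfloor> = int (Suc i)"
      have "real (Suc i) \<le> 2 ^ n * t" using * by linarith
      also have "\<dots> \<le> 2 ^ n * real L" using t by (intro mult_left_mono) auto
      finally have "real (Suc i) \<le> real (L * 2 ^ n)" by (simp add: mult.commute)
      then have "i < L * 2 ^ n" by (simp only: of_nat_le_iff)
      then have "\<bar>x (real (Suc i) / 2 ^ n) - x (real i / 2 ^ n)\<bar> \<le> K * modulus_scale a \<rho> n"
        using n by (intro increments)
      then show ?thesis unfolding dyadic_floor_def i * by simp
    qed
  qed
  have "\<bar>x (dyadic_floor n t) - x (dyadic_floor n s)\<bar> \<le> K * modulus_scale a \<rho> n"
    using adj[of t s] adj[of s t] t s ts by (cases "s \<le> t") (auto simp: abs_minus_commute)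
  moreover have "\<bar>y t - x (dyadic_floor n t)\<bar> \<le> K * modulus_scale a \<rho> n * modulus_sum a \<rho>" by (rule approx[OF t n])
  moreover have "\<bar>y s - x (dyadic_floor n s)\<bar> \<le> K * modulus_scale a \<rho> n * modulus_sum a \<rho>" by (rule approx[OF s n])
  moreover have "K' * modulus_scale a \<rho> n = K * modulus_scale a \<rho> n * modulus_sum a \<rho> + K * modulus_scale a \<rho> n * modulus_sum a \<rho> + K * modulus_scale a \<rho> n"
    by (simp add: K'_def algebra_simps)
  ultimately show ?thesis by linarith
qed

text \<open>At level n0 there are finitely many grid values, and the path stays within a fixed
  distance of them.\<close>

lemma bounded: "\<exists>B. \<forall>t::real. 0 \<le> t \<and> t \<le> L \<longrightarrow> \<bar>y t\<bar> \<le> B"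
proof (intro exI allI impI)
  fix t :: real assume t: "0 \<le> t \<and> t \<le> L"
  define i where "i = nat \<lfloor>2 ^ n0 * t\<rfloor>"
  have i: "real_of_int \<lfloor>2 ^ n0 * t\<rfloor> = real i" using t by (simp add: i_def)
  have "real i \<le> 2 ^ n0 * t" using i by linarith
  also have "\<dots> \<le> 2 ^ n0 * real L" using t by (intro mult_left_mono) auto
  finally have "real i \<le> real (2 ^ n0 * L)" by simp
  then have "i \<le> 2 ^ n0 * L" by (simp only: of_nat_le_iff)
  then have "\<bar>x (real i / 2 ^ n0)\<bar> \<le> (\<Sum>i\<le>2 ^ n0 * L. \<bar>x (real i / 2 ^ n0)\<bar>)"
    by (intro member_le_sum) auto
  moreover have "\<bar>y t - x (real i / 2 ^ n0)\<bar> \<le> K * modulus_scale a \<rho> n0 * modulus_sum a \<rho>"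
    using approx[of t n0] t unfolding dyadic_floor_def i by simp
  ultimately show "\<bar>y t\<bar> \<le> (\<Sum>i\<le>2 ^ n0 * L. \<bar>x (real i / 2 ^ n0)\<bar>) + K * modulus_scale a \<rho> n0 * modulus_sum a \<rho>"
    by linarith
qed

end

text \<open>The least N with 2^(-N) < \<delta> exceeds n0; its predecessor is the level
  sought.\<close>

lemma dyadic_scale:
  fixes \<delta> :: real
  assumes \<delta>: "0 < \<delta>" "\<delta> \<le> (1/2) ^ n0"
  obtains n where "n0 \<le> n" "(1/2) ^ Suc n < \<delta>" "\<delta> \<le> (1/2) ^ n"
proof -
  obtain N0 :: nat where N0: "(1/2) ^ N0 < \<delta>" using real_arch_pow_inv[of \<delta> "1/2"] \<delta> by auto
  define N where "N = (LEAST N. (1/2) ^ N < \<delta>)"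
  have N: "(1/2) ^ N < \<delta>" unfolding N_def using N0 by (rule LeastI)
  have min: "\<delta> \<le> (1/2) ^ k" if "k < N" for k
    using not_less_Least[of k "\<lambda>N. (1/2) ^ N < \<delta>"] that by (simp add: N_def)
  have "n0 < N"
  proof (rule ccontr)
    assume "\<not> n0 < N"
    then have "(1/2::real) ^ n0 \<le> (1/2) ^ N" by (intro power_decreasing) auto
    then show False using N \<delta> by linarith
  qed
  then show thesis using N min[of "N - 1"] by (intro that[of "N - 1"]) auto
qed

context dyadic_path
begin

text \<open>The spare power a - \<kappa> absorbs the polynomial factor in n; pairs further apart
  than 2^(-n0) are covered by boundedness.\<close>

lemma holder:
  assumes \<kappa>: "0 < \<kappa>" "\<kappa> < a"
  shows "\<exists>B. \<forall>(t::real) (s::real). 0 \<le> t \<and> t \<le> L \<and> 0 \<le> s \<and> s \<le> L \<longrightarrow> \<bar>y t - y s\<bar> \<le> B * \<bar>t - s\<bar> powr \<kappa>"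
proof -
  obtain B0 where B0: "\<And>t :: real. 0 \<le> t \<Longrightarrow> t \<le> L \<Longrightarrow> \<bar>y t\<bar> \<le> B0" using bounded by auto
  have "(\<lambda>k. modulus_scale (a - \<kappa>) \<rho> (1 + k)) \<longlonglongrightarrow> 0"
    using \<kappa> by (intro summable_LIMSEQ_zero modulus_scale_sums(1) \<rho>) auto
  then obtain B1 where B1: "\<And>k. norm (modulus_scale (a - \<kappa>) \<rho> (1 + k)) \<le> B1"
    using BseqE[OF convergent_imp_Bseq[OF convergentI]] by metis
  define c :: real where "c = 2 powr \<kappa>"
  define B where "B = K' * B1 * c + 2 * B0 * (2 ^ n0) powr \<kappa>"
  have "0 \<le> B0" using B0[of 0] by simp
  have "0 \<le> B1" using B1[of 0] norm_ge_zero order_trans by blast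
  have main: "\<bar>y t - y s\<bar> \<le> B * \<bar>t - s\<bar> powr \<kappa>" if t: "0 \<le> t" "t \<le> L" and s: "0 \<le> s" "s \<le> L" for t s :: real
  proof (cases "t = s")
    case False
    define \<delta> where "\<delta> = \<bar>t - s\<bar>"
    have \<delta>: "0 < \<delta>" using False by (simp add: \<delta>_def)
    show ?thesis
    proof (cases "\<delta> \<le> (1/2) ^ n0")
      case True
      obtain n where n: "n0 \<le> n" "(1/2) ^ Suc n < \<delta>" "\<delta> \<le> (1/2) ^ n"
        using dyadic_scale[OF \<delta> True] .
      have "\<bar>y t - y s\<bar> \<le> K' * modulus_scale a \<rho> n"
        using n by (intro increment_le t s) (auto simp: \<delta>_def)
      also have "modulus_scale a \<rho> n = ((1/2) ^ n) powr \<kappa> * modulus_scale (a - \<kappa>) \<rho> n"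
        by (simp add: modulus_scale_def flip: powr_add mult.assoc)
      also have "K' * \<dots> \<le> K' * ((c * \<delta> powr \<kappa>) * B1)"
      proof (intro mult_left_mono mult_mono K'_nonneg)
        have "((1/2::real) ^ n) powr \<kappa> \<le> (2 * \<delta>) powr \<kappa>"
          using n \<kappa> by (intro powr_mono2) auto
        also have "\<dots> = c * \<delta> powr \<kappa>" unfolding c_def by (rule powr_mult)
        finally show "((1/2) ^ n) powr \<kappa> \<le> c * \<delta> powr \<kappa>" .
        show "modulus_scale (a - \<kappa>) \<rho> n \<le> B1"
          using B1[of "n - 1"] n n0 modulus_scale_nonneg[of "a - \<kappa>" \<rho> n] by simp
      qed (auto simp: c_def modulus_scale_nonneg)
      also have "\<dots> \<le> B * \<delta> powr \<kappa>"
        using \<open>0 \<le> B0\<close> by (simp add: B_def ring_distribs mult_ac)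
      finally show ?thesis by (simp add: \<delta>_def)
    next
      case False
      have "\<bar>y t - y s\<bar> \<le> 2 * B0" using B0[OF t] B0[OF s] by linarith
      also have "\<dots> \<le> 2 * B0 * (2 ^ n0 * \<delta>) powr \<kappa>"
      proof -
        have "1 \<le> 2 ^ n0 * \<delta>" using False by (simp add: field_simps)
        then have "1 \<le> (2 ^ n0 * \<delta>) powr \<kappa>" using \<kappa> by (intro ge_one_powr_ge_zero) auto
        then show ?thesis using mult_left_mono[of 1 "(2 ^ n0 * \<delta>) powr \<kappa>" "2 * B0"] \<open>0 \<le> B0\<close> by simp
      qed
      also have "\<dots> = 2 * B0 * (2 ^ n0) powr \<kappa> * \<delta> powr \<kappa>" by (simp only: powr_mult mult.assoc)
      also have "\<dots> \<le> B * \<delta> powr \<kappa>"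
        using K'_nonneg \<open>0 \<le> B1\<close> by (intro mult_right_mono) (auto simp: B_def c_def)
      finally show ?thesis by (simp add: \<delta>_def)
    qed
  qed simp
  show ?thesis
  proof (intro exI[of _ B] allI impI)
    fix t s :: real assume "0 \<le> t \<and> t \<le> L \<and> 0 \<le> s \<and> s \<le> L"
    then show "\<bar>y t - y s\<bar> \<le> B * \<bar>t - s\<bar> powr \<kappa>" by (intro main) auto
  qed
qed

lemma modulus:
  fixes T :: real
  assumes T: "0 \<le> T" "T \<le> L"
  shows "(\<lambda>\<delta>. Sup {\<bar>y t - y s\<bar> | t s. t \<in> {0..T} \<and> s \<in> {0..T} \<and> \<bar>t - s\<bar> < \<delta>})
    \<in> O[at_right 0](\<lambda>\<delta>. \<delta> powr a * \<bar>ln \<delta>\<bar> powr \<rho>)"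
proof (rule bigoI)
  \<comment> \<open>2^a comes from 2^(-n) <= 2 \<delta>, and the power of 1 / ln 2 from n ln 2 <=
    |ln \<delta>|.\<close>
  define c where "c = K' * 2 powr a * (1 / ln 2) powr \<rho>"
  show "\<forall>\<^sub>F \<delta> in at_right 0. norm (Sup {\<bar>y t - y s\<bar> | t s. t \<in> {0..T} \<and> s \<in> {0..T} \<and> \<bar>t - s\<bar> < \<delta>})
    \<le> c * norm (\<delta> powr a * \<bar>ln \<delta>\<bar> powr \<rho>)"
    unfolding eventually_at_right_field
  proof (intro exI[of _ "(1/2) ^ n0"] conjI allI impI)
    fix \<delta> :: real assume \<delta>: "0 < \<delta>" "\<delta> < (1/2) ^ n0"
    obtain n where n: "n0 \<le> n" "(1/2) ^ Suc n < \<delta>" "\<delta> \<le> (1/2) ^ n"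
      using dyadic_scale[of \<delta> n0] \<delta> by auto
    let ?A = "{\<bar>y t - y s\<bar> | t s. t \<in> {0..T} \<and> s \<in> {0..T} \<and> \<bar>t - s\<bar> < \<delta>}"
    have le: "z \<le> K' * modulus_scale a \<rho> n" if zA: "z \<in> ?A" for z
    proof -
      obtain t s :: real where z: "z = \<bar>y t - y s\<bar>" and "0 \<le> t" "t \<le> T" "0 \<le> s" "s \<le> T" "\<bar>t - s\<bar> < \<delta>"
        using zA by auto
      then show ?thesis unfolding z using n T by (intro increment_le) auto
    qed
    \<comment> \<open>The pair t = s = 0 makes the set nonempty, so that \<open>Sup\<close> is a
      genuine, nonnegative supremum.\<close>
    have mem: "0 \<in> ?A" using \<delta> T by (auto intro!: exI[of _ "0::real"])
    have S1: "Sup ?A \<le> K' * modulus_scale a \<rho> n" using mem le by (intro cSup_least) auto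
    have S0: "0 \<le> Sup ?A" using mem le by (intro cSup_upper bdd_aboveI)
    have "modulus_scale a \<rho> n \<le> (2 * \<delta>) powr a * (\<bar>ln \<delta>\<bar> / ln 2) powr \<rho>"
      unfolding modulus_scale_def
    proof (intro mult_mono powr_mono2)
      show "(1/2) ^ n \<le> 2 * \<delta>" using n by simp
      have "ln \<delta> \<le> ln ((1/2) ^ n)" using n \<delta> by simp
      also have "\<dots> = - (real n * ln 2)" by (simp add: ln_realpow ln_div)
      finally show "real n \<le> \<bar>ln \<delta>\<bar> / ln 2" by (simp add: field_simps)
    qed (use a \<rho> in auto)
    then have "K' * modulus_scale a \<rho> n \<le> K' * ((2 * \<delta>) powr a * (\<bar>ln \<delta>\<bar> / ln 2) powr \<rho>)"
      using K'_nonneg by (rule mult_left_mono)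
    also have "\<dots> = c * (\<delta> powr a * \<bar>ln \<delta>\<bar> powr \<rho>)"
    proof -
      have "(\<bar>ln \<delta>\<bar> / ln 2) powr \<rho> = (1 / ln 2 * \<bar>ln \<delta>\<bar>) powr \<rho>" by simp
      then show ?thesis unfolding c_def by (simp only: powr_mult) (simp only: mult_ac)
    qed
    finally show "norm (Sup ?A) \<le> c * norm (\<delta> powr a * \<bar>ln \<delta>\<bar> powr \<rho>)"
      using S0 S1 by simp
  qed simp
qed

end

section \<open>The regular version\<close>

lemma log_modulus_smallo:
  fixes a r1 r2 :: real
  assumes "r1 < r2"
  shows "(\<lambda>\<delta>. \<delta> powr a * \<bar>ln \<delta>\<bar> powr r1) \<in> o[at_right 0](\<lambda>\<delta>. \<delta> powr a * \<bar>ln \<delta>\<bar> powr r2)"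
  using assms by real_asymp

context rhmsp
begin

text \<open>As a limit of measurable functions \<open>Y t\<close> is measurable without modification
  on a null set; where the limit fails to exist, \<open>lim\<close> denotes a fixed value.\<close>

definition Y :: "real \<Rightarrow> 'a \<Rightarrow> real" where
  "Y t \<omega> = lim (\<lambda>n. X (dyadic_floor n t) \<omega>)"

lemma Y_measurable: "0 \<le> t \<Longrightarrow> Y t \<in> borel_measurable P"
  unfolding Y_def by (intro borel_measurable_lim_metric X_measurable dyadic_floor_bounds)

lemma Y_eq_path: "dyadic_path.y (\<lambda>t. X t \<omega>) t = Y t \<omega>"
  if "dyadic_path (\<lambda>t. X t \<omega>) K a r L n0" for K a r L n0
  by (simp add: dyadic_path.y_def[OF that] Y_def)

text \<open>Each level contributes a single pair, the point and its dyadic approximation; the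
  resulting bound tends to 0, so the defining limit is \<open>X t\<close>.\<close>

lemma Y_version:
  assumes t: "0 \<le> t"
  shows "AE \<omega> in P. Y t \<omega> = X t \<omega>"
proof -
  \<comment> \<open>The successor keeps the horizon positive at t = 0.\<close>
  define L where "L = Suc (nat \<lceil>t\<rceil>)"
  have tL: "t \<le> real L" unfolding L_def by linarith
  have "AE \<omega> in P. \<forall>\<^sub>F n in sequentially. \<forall>j<1::nat. \<bar>X t \<omega> - X (dyadic_floor n t) \<omega>\<bar>
    \<le> 4 * (((1/2) ^ n) powr Hmin * real n powr (1/\<alpha> + 1/2 + 1))"
  proof (rule dyadic_increments_eventually[where L=L and m="\<lambda>_. 1" and t="\<lambda>_ _. t" and s="\<lambda>n _. dyadic_floor n t" and \<epsilon>=1])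
    show "1 \<le> L * 2 ^ n" for n unfolding One_nat_def Suc_le_eq by (simp add: L_def)
  qed (use t tL dyadic_floor_bounds[OF t] in \<open>auto simp: L_def\<close>)
  then show ?thesis
  proof (rule AE_mp, intro AE_I2 impI)
    fix \<omega>
    assume *: "\<forall>\<^sub>F n in sequentially. \<forall>j<1::nat. \<bar>X t \<omega> - X (dyadic_floor n t) \<omega>\<bar>
      \<le> 4 * (((1/2) ^ n) powr Hmin * real n powr (1/\<alpha> + 1/2 + 1))"
    have "(\<lambda>k. modulus_scale Hmin (1/\<alpha> + 1/2 + 1) (1 + k)) \<longlonglongrightarrow> 0"
      using Hmin_pos \<alpha> by (intro summable_LIMSEQ_zero modulus_scale_sums(1)) auto
    then have "(\<lambda>n. modulus_scale Hmin (1/\<alpha> + 1/2 + 1) n) \<longlonglongrightarrow> 0"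
      by (subst (asm) add.commute) (rule LIMSEQ_offset)
    from tendsto_mult_right_zero[OF this, of 4]
    have "(\<lambda>n. X (dyadic_floor n t) \<omega> - X t \<omega>) \<longlonglongrightarrow> 0"
    proof (rule Lim_null_comparison[rotated])
      show "\<forall>\<^sub>F n in sequentially. norm (X (dyadic_floor n t) \<omega> - X t \<omega>) \<le> 4 * modulus_scale Hmin (1/\<alpha> + 1/2 + 1) n"
        using * by eventually_elim (auto simp: modulus_scale_def abs_minus_commute)
    qed
    then have "(\<lambda>n. X (dyadic_floor n t) \<omega>) \<longlonglongrightarrow> X t \<omega>" by (rule LIM_zero_cancel)
    then show "Y t \<omega> = X t \<omega>" unfolding Y_def by (rule limI)
  qed
qed

lemma dyadic_path_AE:
  assumes L: "0 < L" and \<epsilon>: "0 < \<epsilon>"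
  shows "AE \<omega> in P. \<exists>n0. dyadic_path (\<lambda>t. X t \<omega>) 4 Hmin (1/\<alpha> + 1/2 + \<epsilon>) L n0"
proof -
  have "AE \<omega> in P. \<forall>\<^sub>F n in sequentially. \<forall>j<L * 2 ^ n. \<bar>X (real (Suc j) / 2 ^ n) \<omega> - X (real j / 2 ^ n) \<omega>\<bar>
    \<le> 4 * (((1/2) ^ n) powr Hmin * real n powr (1/\<alpha> + 1/2 + \<epsilon>))"
  proof (rule dyadic_increments_eventually[where m="\<lambda>n. L * 2 ^ n" and t="\<lambda>n j. real (Suc j) / 2 ^ n" and s="\<lambda>n j. real j / 2 ^ n", OF L \<epsilon>])
    fix n j assume j: "j < L * 2 ^ n"
    then have "real (Suc j) \<le> real (L * 2 ^ n)" by (simp only: of_nat_le_iff)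
    then have "real (Suc j) / 2 ^ n \<le> L" by (simp add: pos_divide_le_eq)
    moreover have "real (Suc j) / 2 ^ n - real j / 2 ^ n = (1/2) ^ n"
      by (simp add: power_one_over flip: diff_divide_distrib)
    ultimately show "0 \<le> real (Suc j) / 2 ^ n \<and> real (Suc j) / 2 ^ n \<le> real L \<and> 0 \<le> real j / 2 ^ n
      \<and> \<bar>real (Suc j) / 2 ^ n - real j / 2 ^ n\<bar> \<le> (1/2) ^ n" by simp
  qed simp
  then show ?thesis
  proof (rule AE_mp, intro AE_I2 impI)
    fix \<omega>
    assume "\<forall>\<^sub>F n in sequentially. \<forall>j<L * 2 ^ n. \<bar>X (real (Suc j) / 2 ^ n) \<omega> - X (real j / 2 ^ n) \<omega>\<bar>
      \<le> 4 * (((1/2) ^ n) powr Hmin * real n powr (1/\<alpha> + 1/2 + \<epsilon>))"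
    then obtain N where N: "\<And>n j. N \<le> n \<Longrightarrow> j < L * 2 ^ n \<Longrightarrow>
      \<bar>X (real (Suc j) / 2 ^ n) \<omega> - X (real j / 2 ^ n) \<omega>\<bar> \<le> 4 * (((1/2) ^ n) powr Hmin * real n powr (1/\<alpha> + 1/2 + \<epsilon>))"
      unfolding eventually_sequentially by blast
    have "dyadic_path (\<lambda>t. X t \<omega>) 4 Hmin (1/\<alpha> + 1/2 + \<epsilon>) L (max N 1)"
      using Hmin_pos \<alpha> \<epsilon> N by unfold_locales (auto simp: modulus_scale_def simp del: of_nat_Suc)
    then show "\<exists>n0. dyadic_path (\<lambda>t. X t \<omega>) 4 Hmin (1/\<alpha> + 1/2 + \<epsilon>) L n0" ..
  qed
qed

text \<open>One null set must serve all T and \<kappa>. Integer horizons are countable, and on a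
  given path the bound holds for every \<kappa> at once. The choice \<epsilon> = 1 is immaterial,
  since every logarithmic power is absorbed.\<close>

lemma Y_holder:
  "AE \<omega> in P. \<forall>T>0. \<forall>\<kappa>. 0 < \<kappa> \<and> \<kappa> < Hmin \<longrightarrow>
    (\<exists>K. \<forall>t\<in>{0..T}. \<forall>s\<in>{0..T}. \<bar>Y t \<omega> - Y s \<omega>\<bar> \<le> K * \<bar>t - s\<bar> powr \<kappa>)"
proof -
  have "AE \<omega> in P. \<forall>k. \<exists>n0. dyadic_path (\<lambda>t. X t \<omega>) 4 Hmin (1/\<alpha> + 1/2 + 1) (Suc k) n0"
    unfolding AE_all_countable by (intro allI dyadic_path_AE) auto
  then show ?thesis
  proof (rule AE_mp, intro AE_I2 impI allI)
    fix \<omega> and T \<kappa> :: real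
    assume paths: "\<forall>k. \<exists>n0. dyadic_path (\<lambda>t. X t \<omega>) 4 Hmin (1/\<alpha> + 1/2 + 1) (Suc k) n0"
      and \<kappa>: "0 < \<kappa> \<and> \<kappa> < Hmin"
    obtain n0 where path: "dyadic_path (\<lambda>t. X t \<omega>) 4 Hmin (1/\<alpha> + 1/2 + 1) (Suc (nat \<lceil>T\<rceil>)) n0"
      using paths by blast
    have TL: "T \<le> real (Suc (nat \<lceil>T\<rceil>))" by linarith
    obtain B where B: "\<And>t s. 0 \<le> t \<and> t \<le> real (Suc (nat \<lceil>T\<rceil>)) \<and> 0 \<le> s \<and> s \<le> real (Suc (nat \<lceil>T\<rceil>))
      \<Longrightarrow> \<bar>Y t \<omega> - Y s \<omega>\<bar> \<le> B * \<bar>t - s\<bar> powr \<kappa>"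
      using dyadic_path.holder[OF path, of \<kappa>] \<kappa> unfolding Y_eq_path[OF path] by blast
    show "\<exists>K. \<forall>t\<in>{0..T}. \<forall>s\<in>{0..T}. \<bar>Y t \<omega> - Y s \<omega>\<bar> \<le> K * \<bar>t - s\<bar> powr \<kappa>"
      by (intro exI[of _ B] ballI B) (use TL in auto)
  qed
qed

text \<open>Chaining yields an O with \<epsilon>/2 in the exponent; the other half of \<epsilon>
  turns it into an o.\<close>

lemma Y_modulus:
  assumes T: "0 < T" and \<epsilon>: "0 < \<epsilon>"
  shows "AE \<omega> in P. (\<lambda>\<delta>. Sup {\<bar>Y t \<omega> - Y s \<omega>\<bar> | t s. t \<in> {0..T} \<and> s \<in> {0..T} \<and> \<bar>t - s\<bar> < \<delta>})
    \<in> o[at_right 0](\<lambda>\<delta>. \<delta> powr Hmin * \<bar>ln \<delta>\<bar> powr (1/\<alpha> + 1/2 + \<epsilon>))"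
proof -
  have "AE \<omega> in P. \<exists>n0. dyadic_path (\<lambda>t. X t \<omega>) 4 Hmin (1/\<alpha> + 1/2 + \<epsilon> / 2) (Suc (nat \<lceil>T\<rceil>)) n0"
    using \<epsilon> by (intro dyadic_path_AE) auto
  then show ?thesis
  proof (rule AE_mp, intro AE_I2 impI, elim exE)
    fix \<omega> n0
    assume path: "dyadic_path (\<lambda>t. X t \<omega>) 4 Hmin (1/\<alpha> + 1/2 + \<epsilon> / 2) (Suc (nat \<lceil>T\<rceil>)) n0"
    have TL: "T \<le> real (Suc (nat \<lceil>T\<rceil>))" by linarith
    have "(\<lambda>\<delta>. Sup {\<bar>Y t \<omega> - Y s \<omega>\<bar> | t s. t \<in> {0..T} \<and> s \<in> {0..T} \<and> \<bar>t - s\<bar> < \<delta>})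
      \<in> O[at_right 0](\<lambda>\<delta>. \<delta> powr Hmin * \<bar>ln \<delta>\<bar> powr (1/\<alpha> + 1/2 + \<epsilon> / 2))"
      using dyadic_path.modulus[OF path less_imp_le[OF T] TL] unfolding Y_eq_path[OF path] .
    then show "(\<lambda>\<delta>. Sup {\<bar>Y t \<omega> - Y s \<omega>\<bar> | t s. t \<in> {0..T} \<and> s \<in> {0..T} \<and> \<bar>t - s\<bar> < \<delta>})
      \<in> o[at_right 0](\<lambda>\<delta>. \<delta> powr Hmin * \<bar>ln \<delta>\<bar> powr (1/\<alpha> + 1/2 + \<epsilon>))"
      using \<epsilon> by (intro landau_o.big_small_trans[OF _ log_modulus_smallo]) auto
  qed
qed

end

theorem mainTheorem4:
  fixes P :: "'a measure" and \<alpha> :: real and H :: "real \<Rightarrow> real"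
    and X :: "real \<Rightarrow> 'a \<Rightarrow> real" and C \<gamma> :: real
  assumes "prob_space P"
    and "1 < \<alpha>" and "\<alpha> < 2"
    and "bdd_below (H ` {0..})" and "bdd_above (H ` {0..})"
    and "0 < (INF t\<in>{0..}. H t)" and "(SUP t\<in>{0..}. H t) < 1"
    and "0 < C" and "(SUP t\<in>{0..}. H t) < \<gamma>"
    and "\<forall>t\<ge>0. \<forall>s\<ge>0. \<bar>H t - H s\<bar> \<le> C * \<bar>t - s\<bar> powr \<gamma>"
    and "is_rhmsp P \<alpha> H X"
  shows "\<exists>Y :: real \<Rightarrow> 'a \<Rightarrow> real.
     (\<forall>t\<ge>0. Y t \<in> borel_measurable P) \<and>
     (\<forall>t\<ge>0. AE \<omega> in P. Y t \<omega> = X t \<omega>) \<and>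
     (AE \<omega> in P. \<forall>T>0. \<forall>\<kappa>. 0 < \<kappa> \<and> \<kappa> < (INF t\<in>{0..}. H t) \<longrightarrow>
        (\<exists>K. \<forall>t\<in>{0..T}. \<forall>s\<in>{0..T}. \<bar>Y t \<omega> - Y s \<omega>\<bar> \<le> K * \<bar>t - s\<bar> powr \<kappa>)) \<and>
     (\<forall>T>0. \<forall>\<epsilon>>0. AE \<omega> in P.
        (\<lambda>\<delta>. Sup {\<bar>Y t \<omega> - Y s \<omega>\<bar> | t s. t \<in> {0..T} \<and> s \<in> {0..T} \<and> \<bar>t - s\<bar> < \<delta>})
        \<in> o[at_right 0](\<lambda>\<delta>. \<delta> powr (INF t\<in>{0..}. H t) *
                              \<bar>ln \<delta>\<bar> powr (1 / \<alpha> + 1 / 2 + \<epsilon>)))"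
proof -
  interpret rhmsp P \<alpha> H X C \<gamma>
    using assms by (intro rhmsp.intro rhmsp_axioms.intro)
  show ?thesis
    using Y_measurable Y_version Y_holder Y_modulus unfolding Hmin_def
    by (intro exI[of _ Y] conjI allI impI)
qed

end
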